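(* Let $d\ge 2$ and $N\ge 1$ be integers, let $\alpha>0$, and let $f:\mathbb{R}\to[0,1]$ be a monotone differentiable function such that $f$ and $f'$ are non-zero on $[-\alpha,\alpha]$ and the quantities $$L_\alpha=\sup_{|x|\le\alpha}\frac{|f'(x)|}{f(x)(1-f(x))},\qquad \beta_\alpha=\sup_{|x|\le\alpha}\frac{f(x)(1-f(x))}{(f'(x))^2},\qquad U_\alpha=\sup_{|x|\le\alpha}\log\Big(\frac{1}{f(x)(1-f(x))}\Big)$$ are well defined (finite). Let $T^\sharp\in\mathbb{R}^{N^d}$ (an order-$d$ tensor with all side lengths $N$) satisfy $\|T^\sharp\|_\infty\le\alpha$. Suppose $m$ 1-bit measurements of entries of $T^\sharp$, with $2\le m\le N^d$, are acquired according to the observation model described in the context, with sampling distribution $\Pi=\{\pi_\omega\}_{\omega\in[N]^d}$, and let $\mathcal{L}_{\Omega,Y}$ be the associated negative log-likelihood. There exist absolute constants $C_{\max}$ and $C_M$ such that the following hold for every $0<\delta<1$. (i) If $\|T^\sharp\|_{\max}\le R_{\max}$, then the minimizer $\hat T_{\max}$ of $\mathcal{L}_{\Omega,Y}(X)$ over $X\in K^T_{\max}(\alpha,R_{\max})$ satisfies, with probability at least $1-\delta$, $$\|T^\sharp-\hat T_{\max}\|_\Pi^2:=\sum_{\omega}\pi_\omega\big(\hat T_{\max}(\omega)-T^\sharp(\omega)\big)^2\le C_{\max}\,c_2^d\,\beta_\alpha\Big\{L_\alpha R_{\max}\sqrt{\frac{dN}{m}}+U_\alpha\sqrt{\frac{\log(4/\delta)}{m}}\Big\}.$$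 (ii) If $\|T^\sharp\|_{M}\le R_{M}$, then the minimizer $\hat T_{M}$ of $\mathcal{L}_{\Omega,Y}(X)$ over $X\in K^T_{M}(\alpha,R_{M})$ satisfies, with probability at least $1-\delta$, $$\|T^\sharp-\hat T_{M}\|_\Pi^2=\sum_{\omega}\pi_\omega\big(\hat T_{M}(\omega)-T^\sharp(\omega)\big)^2\le C_{M}\,\beta_\alpha\Big\{L_\alpha R_{M}\sqrt{\frac{dN}{m}}+U_\alpha\sqrt{\frac{\log(4/\delta)}{m}}\Big\}.$$ Here "absolute" means that $C_{\max},C_M$ do not depend on $N,d,m,\alpha,f,\Pi,T^\sharp,R_{\max},R_M,\delta$, and $c_2$ is the fixed numerical constant described in the context.
   Context: Notation. $[N]=\{1,\dots,N\}$; $\mathbb{R}^{N^d}$ denotes order-$d$ tensors with all dimensions equal to $N$; entries are written $T_\omega$ or $T(\omega)$ for $\omega=(i_1,\dots,i_d)\in[N]^d$; $\|T\|_\infty=\max_\omega|T_\omega|$. Max-qnorm. For matrices $U^{(j)}\in\mathbb{R}^{N\times k}$, $j=1,\dots,d$ (with a common, arbitrary number $k$ of columns), $U^{(1)}\circ\cdots\circ U^{(d)}$ is the tensor with entries $\sum_{l=1}^k U^{(1)}(i_1,l)\cdots U^{(d)}(i_d,l)$. $\|U\|_{2,\infty}$ is the maximum Euclidean norm of a row of $U$. Define $$\|T\|_{\max}=\min\Big\{\prod_{j=1}^d\|U^{(j)}\|_{2,\infty}: T=U^{(1)}\circ\cdots\circ U^{(d)}\Big\}.$$ M-norm. Let $T_\pm$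 be the set of rank-one tensors with all entries in $\{\pm1\}$ (a rank-one tensor being a nonzero outer product of $d$ vectors). Define $\|T\|_M=\inf\{t>0: T\in t\,\mathrm{conv}(T_\pm)\}$. Constraint sets. $K^T_{\max}(\alpha,R)=\{T:\|T\|_\infty\le\alpha,\ \|T\|_{\max}\le R\}$ and $K^T_{M}(\alpha,R)=\{T:\|T\|_\infty\le\alpha,\ \|T\|_{M}\le R\}$. Constants. $c_1,c_2$ are fixed numerical constants coming from the generalized Grothendieck theorem, such that $\|T\|_M\le c_1c_2^d\|T\|_{\max}$ for every order-$d$ tensor $T$. Observation model. $\Pi=\{\pi_\omega\}_{\omega\in[N]^d}$ is a probability distribution on the indices ($\pi_\omega\ge0$, $\sum_\omega\pi_\omega=1$). Indices $\omega_1,\dots,\omega_m$ are drawn independently from $\Pi$ (with replacement; $\Omega$ denotes the resulting collection counted with multiplicity). For each sampled index a bit is observed, independently across samples given the indices: the bit $Y_{\omega_i}$ equals $+1$ with probability $f(T^\sharp_{\omega_i})$ and $-1$ with probability $1-f(T^\sharp_{\omega_i})$. Negative log-likelihood. $$\mathcal{L}_{\Omega,Y}(X)=\sum_{\omega\in\Omega}\Big(\mathbf{1}_{[Y_\omega=1]}\log\frac1{f(X_\omega)}+\mathbf{1}_{[Y_\omega=-1]}\log\frac1{1-f(X_\omega)}\Big),$$ the sum running over the $m$ samples. "The minimizer" means any minimizer of the constrained problem. *)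

theory Defs
  imports
    "HOL-Probability.Probability"
    "HOL-Probability.Product_PMF"
    "HOL-Analysis.Finite_Function_Topology"
begin

(* Order-d tensors of side N are the finitely supported functions whose support lies in
   the index set [N]^d. This is a real vector space for every N and d, so that
   "convex hull" applies, while N and d stay ordinary natural numbers. *)

type_synonym tensor_index = "nat \<Rightarrow> nat"
type_synonym tensor = "tensor_index \<Rightarrow>\<^sub>0 real"

definition indices :: "nat \<Rightarrow> nat \<Rightarrow> tensor_index set" where
  "indices N d = {1..d} \<rightarrow>\<^sub>E {1..N}"

definition tensors :: "nat \<Rightarrow> nat \<Rightarrow> tensor set" where
  "tensors N d = {T. Poly_Mapping.keys T \<subseteq> indices N d}"

abbreviation entry :: "tensor \<Rightarrow> tensor_index \<Rightarrow> real" where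
  "entry \<equiv> Poly_Mapping.lookup"

definition entry_max_norm :: "nat \<Rightarrow> nat \<Rightarrow> tensor \<Rightarrow> real" where
  "entry_max_norm N d T = (MAX \<omega>\<in>indices N d. \<bar>entry T \<omega>\<bar>)"

(* An N x k matrix is a function of row and column; only the entries with row in {1..N}
   and column in {1..k} are used. *)

definition row_norm :: "nat \<Rightarrow> nat \<Rightarrow> (nat \<Rightarrow> nat \<Rightarrow> real) \<Rightarrow> real" where
  "row_norm N k U = (MAX i\<in>{1..N}. L2_set (U i) {1..k})"

definition factorizes ::
    "nat \<Rightarrow> nat \<Rightarrow> nat \<Rightarrow> (nat \<Rightarrow> nat \<Rightarrow> nat \<Rightarrow> real) \<Rightarrow> tensor \<Rightarrow> bool" where
  "factorizes N d k U T \<longleftrightarrow>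
     (\<forall>\<omega>\<in>indices N d. entry T \<omega> = (\<Sum>l\<in>{1..k}. \<Prod>j\<in>{1..d}. U j (\<omega> j) l))"

(* The minimum over all factorizations is rendered as an infimum, because the number k of
   columns is unbounded; the two agree whenever the minimum is attained. *)
definition max_qnorm :: "nat \<Rightarrow> nat \<Rightarrow> tensor \<Rightarrow> real" where
  "max_qnorm N d T = Inf {\<Prod>j\<in>{1..d}. row_norm N k (U j) | k U. factorizes N d k U T}"

definition rank_one :: "nat \<Rightarrow> nat \<Rightarrow> tensor \<Rightarrow> bool" where
  "rank_one N d T \<longleftrightarrow> T \<in> tensors N d \<and> T \<noteq> 0 \<and>
     (\<exists>v :: nat \<Rightarrow> nat \<Rightarrow> real. \<forall>\<omega>\<in>indices N d. entry T \<omega> = (\<Prod>j\<in>{1..d}. v j (\<omega> j)))"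

definition sign_rank_one :: "nat \<Rightarrow> nat \<Rightarrow> tensor set" where
  "sign_rank_one N d = {T. rank_one N d T \<and> (\<forall>\<omega>\<in>indices N d. entry T \<omega> \<in> {-1, 1})}"

definition M_norm :: "nat \<Rightarrow> nat \<Rightarrow> tensor \<Rightarrow> real" where
  "M_norm N d T = Inf {t. 0 < t \<and> T \<in> (\<lambda>X. t *\<^sub>R X) ` (convex hull sign_rank_one N d)}"

definition K_max :: "nat \<Rightarrow> nat \<Rightarrow> real \<Rightarrow> real \<Rightarrow> tensor set" where
  "K_max N d \<alpha> R = {T \<in> tensors N d. entry_max_norm N d T \<le> \<alpha> \<and> max_qnorm N d T \<le> R}"

definition K_M :: "nat \<Rightarrow> nat \<Rightarrow> real \<Rightarrow> real \<Rightarrow> tensor set" where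
  "K_M N d \<alpha> R = {T \<in> tensors N d. entry_max_norm N d T \<le> \<alpha> \<and> M_norm N d T \<le> R}"

(* Order 1 is excluded: there max_qnorm vanishes identically, since a vector can be spread
   evenly over arbitrarily many columns, so no such constants would exist. *)
definition grothendieck_constants :: "real \<Rightarrow> real \<Rightarrow> bool" where
  "grothendieck_constants c\<^sub>1 c\<^sub>2 \<longleftrightarrow>
     (\<forall>d\<ge>2. \<forall>N\<ge>1. \<forall>T\<in>tensors N d. M_norm N d T \<le> c\<^sub>1 * c\<^sub>2 ^ d * max_qnorm N d T)"

definition L_const :: "real \<Rightarrow> (real \<Rightarrow> real) \<Rightarrow> real" where
  "L_const \<alpha> f = (SUP x\<in>{-\<alpha>..\<alpha>}. \<bar>deriv f x\<bar> / (f x * (1 - f x)))"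

definition \<beta>_const :: "real \<Rightarrow> (real \<Rightarrow> real) \<Rightarrow> real" where
  "\<beta>_const \<alpha> f = (SUP x\<in>{-\<alpha>..\<alpha>}. (f x * (1 - f x)) / (deriv f x)\<^sup>2)"

definition U_const :: "real \<Rightarrow> (real \<Rightarrow> real) \<Rightarrow> real" where
  "U_const \<alpha> f = (SUP x\<in>{-\<alpha>..\<alpha>}. ln (1 / (f x * (1 - f x))))"

(* The denominator f x * (1 - f x) does not vanish on [-\<alpha>, \<alpha>]: if f x = 1, then x is a
   global maximum of f and hence deriv f x = 0. *)
definition admissible_link :: "real \<Rightarrow> (real \<Rightarrow> real) \<Rightarrow> bool" where
  "admissible_link \<alpha> f \<longleftrightarrow>
     (\<forall>x. 0 \<le> f x \<and> f x \<le> 1) \<and> (mono f \<or> antimono f) \<and> f differentiable_on UNIV \<and>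
     (\<forall>x\<in>{-\<alpha>..\<alpha>}. f x \<noteq> 0 \<and> deriv f x \<noteq> 0) \<and>
     bdd_above ((\<lambda>x. \<bar>deriv f x\<bar> / (f x * (1 - f x))) ` {-\<alpha>..\<alpha>}) \<and>
     bdd_above ((\<lambda>x. (f x * (1 - f x)) / (deriv f x)\<^sup>2) ` {-\<alpha>..\<alpha>}) \<and>
     bdd_above ((\<lambda>x. ln (1 / (f x * (1 - f x)))) ` {-\<alpha>..\<alpha>})"

(* Bits are attached to the samples 1..m and not to the tensor indices, so an index that is
   drawn several times receives an independent bit each time. *)

type_synonym observation = "(nat \<Rightarrow> tensor_index) \<times> (nat \<Rightarrow> int)"

definition bit_pmf :: "real \<Rightarrow> int pmf" where
  "bit_pmf p = map_pmf (\<lambda>b. if b then 1 else -1) (bernoulli_pmf p)"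

definition observation_pmf ::
    "nat \<Rightarrow> tensor_index pmf \<Rightarrow> (real \<Rightarrow> real) \<Rightarrow> tensor \<Rightarrow> observation pmf" where
  "observation_pmf m \<pi> f T = do {
     \<omega> \<leftarrow> Pi_pmf {1..m} undefined (\<lambda>_. \<pi>);
     Y \<leftarrow> Pi_pmf {1..m} 0 (\<lambda>i. bit_pmf (f (entry T (\<omega> i))));
     return_pmf (\<omega>, Y)
   }"

definition neg_log_likelihood ::
    "nat \<Rightarrow> (real \<Rightarrow> real) \<Rightarrow> observation \<Rightarrow> tensor \<Rightarrow> real" where
  "neg_log_likelihood m f = (\<lambda>(\<omega>, Y) X. \<Sum>i\<in>{1..m}.
     of_bool (Y i = 1) * ln (1 / f (entry X (\<omega> i))) +
     of_bool (Y i = -1) * ln (1 / (1 - f (entry X (\<omega> i)))))"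

definition sq_dist :: "nat \<Rightarrow> nat \<Rightarrow> tensor_index pmf \<Rightarrow> tensor \<Rightarrow> tensor \<Rightarrow> real" where
  "sq_dist N d \<pi> S T = (\<Sum>\<omega>\<in>indices N d. pmf \<pi> \<omega> * (entry S \<omega> - entry T \<omega>)\<^sup>2)"

end

theory Submission
  imports Defs
begin

text \<open>
  If $X$ minimizes the likelihood over a set containing $T$, its empirical excess risk is at most
  zero, so its expected excess risk, an average of Kullback--Leibler divergences between
  Bernoulli laws, is at most the largest deviation of the empirical from the expected excess risk.
  The expected excess risk dominates the squared distance because $\arcsin\sqrt{f}$ has
  derivative at least $1/(2\sqrt{\beta_\alpha})$ in absolute value. The deviation exceeds its mean
  by at most a multiple of $U_\alpha\sqrt{m\log(4/\delta)}$ by the bounded differences inequality.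
  For the mean, symmetrization and contraction, carried out one sample at a time, lead to a
  Rademacher average of the entries of $X$; being linear in $X$, it is maximal at one of the at most
  $3^{dN}$ rank-one sign tensors, and a maximal inequality for finite classes applies.
  The max-qnorm ball is contained in an M-norm ball of radius $c_1 c_2^d R$.
\<close>

section \<open>Concentration and symmetrization on finite products\<close>

text \<open>Minimality enters only through the comparison of a minimizer with \<open>T\<close>. The
  estimate therefore holds for every constraint set that contains \<open>T\<close> and lies in an
  M-norm ball, and both claims are instances of it. The divergence is not compared with (x - y)^2
  directly: it dominates a squared Hellinger distance, which for Bernoulli laws is a function of a
  difference of angles, and in the angle variable \<beta> is what the mean value theorem asks for.
  Two obstacles shape the rest. The constraint sets are infinite, and the norms are infima that are
  not assumed to be attained, so a tensor of M-norm at most R is only known to be s X with X in the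
  hull and s below any prescribed t > R. The rate sqrt(dN/m) arises because the logarithm of the
  number of sign tensors is of order dN. For the max-qnorm, passing to the larger M-norm ball
  multiplies only the L term by \<open>c\<^sub>1 * c\<^sub>2 ^ d\<close>; putting this factor in
  front of the U term as well requires that it be at least 1.\<close>

lemma expectation_bind_pmf_finite:
  fixes h :: "'b \<Rightarrow> real"
  assumes "finite (set_pmf p)" "\<And>x. x \<in> set_pmf p \<Longrightarrow> finite (set_pmf (q x))"
  shows "measure_pmf.expectation (bind_pmf p q) h =
    measure_pmf.expectation p (\<lambda>x. measure_pmf.expectation (q x) h)"
  using assms
  by (subst pmf_expectation_bind[of "set_pmf p"])
     (auto simp: integral_measure_pmf[of "set_pmf p" p])

lemma expectation_mono_pmf:
  fixes g h :: "'a \<Rightarrow> real"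
  assumes "finite (set_pmf p)" "\<And>x. x \<in> set_pmf p \<Longrightarrow> g x \<le> h x"
  shows "measure_pmf.expectation p g \<le> measure_pmf.expectation p h"
  using assms by (intro integral_mono_AE AE_pmfI integrable_measure_pmf_finite)

lemma finite_set_Pi_pmf:
  assumes "finite I" "\<And>i. i \<in> I \<Longrightarrow> finite (set_pmf (p i))"
  shows "finite (set_pmf (Pi_pmf I dflt p))"
  using assms by (auto simp: set_Pi_pmf)

lemma expectation_Pi_pmf_insert:
  fixes h :: "('i \<Rightarrow> 'a) \<Rightarrow> real"
  assumes "finite I" "i \<notin> I" "\<And>j. j \<in> insert i I \<Longrightarrow> finite (set_pmf (p j))"
  shows "measure_pmf.expectation (Pi_pmf (insert i I) dflt p) h =
    measure_pmf.expectation (p i)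
      (\<lambda>y. measure_pmf.expectation (Pi_pmf I dflt p) (\<lambda>z. h (z(i := y))))"
  using assms
  by (simp add: Pi_pmf_insert' expectation_bind_pmf_finite finite_set_Pi_pmf flip: map_pmf_def)

section \<open>Exponential moments and the bounded differences inequality\<close>

lemma mgf_bounded_range:
  fixes X :: "'a \<Rightarrow> real"
  assumes fin: "finite (set_pmf p)" and l: "0 < l"
    and range: "\<And>x y. x \<in> set_pmf p \<Longrightarrow> y \<in> set_pmf p \<Longrightarrow> X x - X y \<le> c"
  shows "measure_pmf.expectation p (\<lambda>x. exp (l * X x)) \<le>
    exp (l * measure_pmf.expectation p X + l\<^sup>2 * c\<^sup>2 / 8)"
proof -
  \<comment> \<open>Hoeffding's lemma wants an interval. The attained extremes give the shortest
    one, so a bound on the oscillation of X suffices.\<close>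
  define a where "a = Min (X ` set_pmf p)"
  define b where "b = Max (X ` set_pmf p)"
  have ne: "X ` set_pmf p \<noteq> {}" "finite (X ` set_pmf p)"
    using fin by (auto simp: set_pmf_not_empty)
  obtain x y where "x \<in> set_pmf p" "X x = a" "y \<in> set_pmf p" "X y = b"
    using Min_in[OF ne(2,1)] Max_in[OF ne(2,1)] unfolding a_def b_def by auto
  moreover have "X x \<in> {a..b}" if "x \<in> set_pmf p" for x
    using that ne by (auto simp: a_def b_def)
  ultimately have ab: "\<And>x. x \<in> set_pmf p \<Longrightarrow> X x \<in> {a..b}" "b - a \<le> c" "a \<le> b"
    using range by auto
  interpret H: interval_bounded_random_variable "measure_pmf p" X a b
    by unfold_locales (auto intro!: AE_pmfI dest: ab(1))
  define \<mu> where "\<mu> = measure_pmf.expectation p X"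
  have int: "integrable (measure_pmf p) h" for h :: "'a \<Rightarrow> real"
    by (rule integrable_measure_pmf_finite[OF fin])
  have "ennreal (measure_pmf.expectation p (\<lambda>x. exp (l * (X x - \<mu>)))) =
      nn_integral (measure_pmf p) (\<lambda>x. exp (l * (X x - \<mu>)))"
    by (rule nn_integral_eq_integral[symmetric]) (auto intro: int)
  also have "\<dots> \<le> ennreal (exp (l\<^sup>2 * (b - a)\<^sup>2 / 8))"
    using H.Hoeffdings_lemma_nn_integral[OF l] unfolding \<mu>_def .
  finally have "measure_pmf.expectation p (\<lambda>x. exp (l * (X x - \<mu>))) \<le> exp (l\<^sup>2 * (b - a)\<^sup>2 / 8)"
    by simp
  also have "\<dots> \<le> exp (l\<^sup>2 * c\<^sup>2 / 8)"
    using ab by (auto intro!: mult_left_mono power_mono)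
  finally have "exp (l * \<mu>) * measure_pmf.expectation p (\<lambda>x. exp (l * (X x - \<mu>))) \<le>
      exp (l * \<mu>) * exp (l\<^sup>2 * c\<^sup>2 / 8)"
    by simp
  also have "exp (l * \<mu>) * measure_pmf.expectation p (\<lambda>x. exp (l * (X x - \<mu>))) =
      measure_pmf.expectation p (\<lambda>x. exp (l * X x))"
    by (subst integral_mult_right_zero[symmetric])
       (simp add: right_diff_distrib flip: exp_add)
  finally show ?thesis
    by (simp add: \<mu>_def exp_add)
qed

text \<open>Induction on the coordinates takes the place of a martingale. With coordinate i frozen
  at y the induction hypothesis compares F with its conditional mean \<phi> y; averaging differences
  shows that \<phi> again oscillates by at most c, so one more use of Hoeffding's lemma pays for
  coordinate i.\<close>

lemma mgf_bounded_differences: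
  fixes F :: "('i \<Rightarrow> 'a) \<Rightarrow> real" and c :: real
  assumes "finite I" "\<And>i. i \<in> I \<Longrightarrow> finite (set_pmf (p i))" "0 < l"
    and "\<And>i z x y. i \<in> I \<Longrightarrow> F (z(i := x)) - F (z(i := y)) \<le> c"
  shows "measure_pmf.expectation (Pi_pmf I dflt p) (\<lambda>z. exp (l * F z)) \<le>
    exp (l * measure_pmf.expectation (Pi_pmf I dflt p) F + l\<^sup>2 * c\<^sup>2 / 8 * card I)"
  using assms(1,2,4)
proof (induction I arbitrary: F)
  case empty
  then show ?case by simp
next
  case (insert i I)
  define P where "P = Pi_pmf I dflt p"
  define \<phi> where "\<phi> y = measure_pmf.expectation P (\<lambda>z. F (z(i := y)))" for y
  have finP: "finite (set_pmf P)"
    unfolding P_def using insert by (intro finite_set_Pi_pmf) auto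
  have int: "integrable (measure_pmf P) h" for h :: "_ \<Rightarrow> real"
    by (rule integrable_measure_pmf_finite[OF finP])
  have IH: "measure_pmf.expectation P (\<lambda>z. exp (l * F (z(i := y)))) \<le>
      exp (l * \<phi> y + l\<^sup>2 * c\<^sup>2 / 8 * card I)" for y
    unfolding P_def \<phi>_def
  proof (rule insert.IH)
    fix j z x x' assume "j \<in> I"
    with insert.hyps have "j \<noteq> i" by auto
    then show "F ((z(j := x))(i := y)) - F ((z(j := x'))(i := y)) \<le> c"
      using insert.prems(2)[of j "z(i := y)" x x'] \<open>j \<in> I\<close>
      by (simp only: fun_upd_twist[OF \<open>j \<noteq> i\<close>] insertI2)
  qed (use insert.prems in auto)
  have "\<phi> x - \<phi> y \<le> c" for x y
  proof -
    have "\<phi> x - \<phi> y = measure_pmf.expectation P (\<lambda>z. F (z(i := x)) - F (z(i := y)))"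
      unfolding \<phi>_def by (subst Bochner_Integration.integral_diff) (auto intro: int)
    also have "\<dots> \<le> measure_pmf.expectation P (\<lambda>_. c)"
      by (intro expectation_mono_pmf finP insert.prems insertI1)
    finally show ?thesis by simp
  qed
  then have mgf: "measure_pmf.expectation (p i) (\<lambda>y. exp (l * \<phi> y)) \<le>
      exp (l * measure_pmf.expectation (p i) \<phi> + l\<^sup>2 * c\<^sup>2 / 8)"
    using insert.prems by (intro mgf_bounded_range assms(3)) auto
  have "measure_pmf.expectation (Pi_pmf (insert i I) dflt p) (\<lambda>z. exp (l * F z)) =
      measure_pmf.expectation (p i) (\<lambda>y. measure_pmf.expectation P (\<lambda>z. exp (l * F (z(i := y)))))"
    unfolding P_def using insert by (subst expectation_Pi_pmf_insert) auto
  also have "\<dots> \<le> measure_pmf.expectation (p i) (\<lambda>y. exp (l\<^sup>2 * c\<^sup>2 / 8 * card I) * exp (l * \<phi> y))"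
    using insert.prems IH by (intro expectation_mono_pmf) (auto simp: mult.commute simp flip: exp_add)
  also have "\<dots> \<le> exp (l\<^sup>2 * c\<^sup>2 / 8 * card I) *
      exp (l * measure_pmf.expectation (p i) \<phi> + l\<^sup>2 * c\<^sup>2 / 8)"
    using mgf by simp
  also have "measure_pmf.expectation (p i) \<phi> = measure_pmf.expectation (Pi_pmf (insert i I) dflt p) F"
    unfolding P_def \<phi>_def using insert by (subst expectation_Pi_pmf_insert) auto
  finally show ?case
    using insert.hyps by (simp add: algebra_simps add_divide_distrib flip: exp_add)
qed

lemma bounded_differences_tail:
  fixes F :: "('i \<Rightarrow> 'a) \<Rightarrow> real" and c :: real
  assumes "finite I" "I \<noteq> {}" "\<And>i. i \<in> I \<Longrightarrow> finite (set_pmf (p i))" "0 < c" "0 < s"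
    and "\<And>i z x y. i \<in> I \<Longrightarrow> F (z(i := x)) - F (z(i := y)) \<le> c"
  shows "measure_pmf.prob (Pi_pmf I dflt p)
      {z. measure_pmf.expectation (Pi_pmf I dflt p) F + s \<le> F z} \<le> exp (- 2 * s\<^sup>2 / (card I * c\<^sup>2))"
proof -
  define P where "P = Pi_pmf I dflt p"
  define \<mu> where "\<mu> = measure_pmf.expectation P F"
  define n where "n = real (card I)"
  have n: "0 < n" using assms(1,2) by (auto simp: n_def card_gt_0_iff)
  \<comment> \<open>The minimizer of the Chernoff exponent
    \<open>l\<^sup>2 * c\<^sup>2 / 8 * n - l * s\<close>.\<close>
  define l where "l = 4 * s / (n * c\<^sup>2)"
  have l: "0 < l" unfolding l_def using assms(4,5) n by auto
  have finP: "finite (set_pmf P)"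
    unfolding P_def using assms by (intro finite_set_Pi_pmf) auto
  have "measure_pmf.prob P {z. \<mu> + s \<le> F z} =
      measure_pmf.prob P {z \<in> space (measure_pmf P). exp (l * (\<mu> + s)) \<le> exp (l * F z)}"
    using l by simp
  also have "\<dots> \<le> measure_pmf.expectation P (\<lambda>z. exp (l * F z)) / exp (l * (\<mu> + s))"
    by (rule integral_Markov_inequality_measure[where A = UNIV])
       (auto intro!: integrable_measure_pmf_finite finP)
  also have "\<dots> \<le> exp (l * \<mu> + l\<^sup>2 * c\<^sup>2 / 8 * n) / exp (l * (\<mu> + s))"
    unfolding P_def \<mu>_def n_def
    by (intro divide_right_mono mgf_bounded_differences) (use assms l in auto)
  also have "\<dots> = exp (l\<^sup>2 * c\<^sup>2 / 8 * n - l * s)"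
    by (simp add: algebra_simps flip: exp_diff)
  also have "l\<^sup>2 * c\<^sup>2 / 8 * n - l * s = - 2 * s\<^sup>2 / (n * c\<^sup>2)"
    using n assms(4) by (simp add: l_def field_simps power2_eq_square)
  finally show ?thesis unfolding P_def \<mu>_def n_def .
qed

section \<open>Symmetrization, contraction and a maximal inequality for finite classes\<close>

lemma expectation_pmf_commute:
  fixes h :: "'a \<Rightarrow> 'b \<Rightarrow> real"
  assumes "finite (set_pmf p)" "finite (set_pmf q)"
  shows "measure_pmf.expectation p (\<lambda>x. measure_pmf.expectation q (h x)) =
    measure_pmf.expectation q (\<lambda>y. measure_pmf.expectation p (\<lambda>x. h x y))"
proof -
  have "(\<Sum>x\<in>set_pmf p. \<Sum>y\<in>set_pmf q. pmf p x * (pmf q y * h x y)) =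
      (\<Sum>y\<in>set_pmf q. \<Sum>x\<in>set_pmf p. pmf q y * (pmf p x * h x y))"
    by (subst sum.swap) (simp only: mult.left_commute)
  with assms show ?thesis
    by (simp add: integral_measure_pmf[of "set_pmf p" p] integral_measure_pmf[of "set_pmf q" q]
        sum_distrib_left)
qed

lemma sum_insert_fun_upd:
  assumes "finite I" "i \<notin> I"
  shows "(\<Sum>j\<in>insert i I. w ((z(i := y)) j)) = w y + (\<Sum>j\<in>I. w (z j))"
proof -
  have "(\<Sum>j\<in>I. w ((z(i := y)) j)) = (\<Sum>j\<in>I. w (z j))"
    using assms by (intro sum.cong) auto
  with assms show ?thesis by simp
qed

lemma Max_image_attained:
  assumes "finite K" "K \<noteq> {}"
  shows "\<exists>x\<in>K. Max (f ` K) = f x"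
proof -
  have "Max (f ` K) \<in> f ` K" using assms by (intro Max_in) auto
  then show ?thesis by (auto simp del: Max_in)
qed

definition rademacher_pmf :: "real pmf" where
  "rademacher_pmf = pmf_of_set {-1, 1}"

lemma set_rademacher_pmf: "set_pmf rademacher_pmf = {-1, 1}"
  by (simp add: rademacher_pmf_def)

lemma expectation_rademacher_pmf:
  fixes h :: "real \<Rightarrow> real"
  shows "measure_pmf.expectation rademacher_pmf h = (h 1 + h (-1)) / 2"
  by (simp add: rademacher_pmf_def integral_pmf_of_set)

lemma expectation_pair_pmf_finite:
  fixes h :: "'a \<times> 'b \<Rightarrow> real"
  assumes "finite (set_pmf p)" "finite (set_pmf q)"
  shows "measure_pmf.expectation (pair_pmf p q) h =
    measure_pmf.expectation p (\<lambda>x. measure_pmf.expectation q (\<lambda>y. h (x, y)))"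
  using assms
  by (simp add: pair_pmf_def expectation_bind_pmf_finite flip: map_pmf_def)

text \<open>
  No independent copy of the sample is needed: splitting $A$ into two halves bounds the
  maximum by a term with the expectation and a term with the random value.
\<close>
lemma symmetrization_contraction_step:
  fixes A :: "'k \<Rightarrow> real"
  assumes fin: "finite (set_pmf p)" and K: "finite K" "K \<noteq> {}"
    and dom: "\<And>X X' z. X \<in> K \<Longrightarrow> X' \<in> K \<Longrightarrow> z \<in> set_pmf p \<Longrightarrow>
      g X z - g X' z \<le> \<bar>h X z - h X' z\<bar>"
  shows "measure_pmf.expectation p
      (\<lambda>z. MAX X\<in>K. A X + (measure_pmf.expectation p (g X) - g X z)) \<le>
    measure_pmf.expectation (pair_pmf p rademacher_pmf)
      (\<lambda>(z, e). MAX X\<in>K. A X + 2 * e * h X z)"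
proof -
  define G where "G e z = (MAX X\<in>K. A X / 2 + e * g X z)" for e :: real and z
  define H where "H e z = (MAX X\<in>K. A X + 2 * e * h X z)" for e :: real and z
  have int: "integrable (measure_pmf p) \<phi>" for \<phi> :: "_ \<Rightarrow> real"
    by (rule integrable_measure_pmf_finite[OF fin])
  have G_ge: "A X / 2 + e * g X z \<le> G e z" if "X \<in> K" for X e z
    unfolding G_def using that K by auto
  have H_ge: "A X + 2 * e * h X z \<le> H e z" if "X \<in> K" for X e z
    unfolding H_def using that K by auto
  have 1: "(MAX X\<in>K. A X + (measure_pmf.expectation p (g X) - g X z)) \<le>
      measure_pmf.expectation p (G 1) + G (-1) z" for z
  proof (rule Max.boundedI)
    fix r assume "r \<in> (\<lambda>X. A X + (measure_pmf.expectation p (g X) - g X z)) ` K"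
    then obtain X where X: "X \<in> K"
      and r: "r = A X + (measure_pmf.expectation p (g X) - g X z)" by blast
    have "A X / 2 + measure_pmf.expectation p (g X) =
        measure_pmf.expectation p (\<lambda>z. A X / 2 + 1 * g X z)"
      by (subst Bochner_Integration.integral_add) (auto intro: int)
    also have "\<dots> \<le> measure_pmf.expectation p (G 1)"
      using G_ge[OF X, of 1] by (intro expectation_mono_pmf fin) auto
    finally show "r \<le> measure_pmf.expectation p (G 1) + G (-1) z"
      using G_ge[OF X, of "-1" z] r by simp
  qed (use K in auto)
  \<comment> \<open>This is the contraction. The two maxima are attained at some X and X', and g
    enters only through g X z - g X' z, which \<open>dom\<close> replaces by a difference of h. The
    absolute value is resolved by giving the sign +1 to whichever of X, X' has the larger h. The two
    halves of A, averaged over the two signs, account for the factor 2 in front of h.\<close>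
  have 2: "G 1 z + G (-1) z \<le> (H 1 z + H (-1) z) / 2" if z: "z \<in> set_pmf p" for z
  proof -
    have "\<exists>X\<in>K. G e z = A X / 2 + e * g X z" for e
      unfolding G_def by (intro Max_image_attained K)
    then obtain X X' where X: "X \<in> K" "G 1 z = A X / 2 + 1 * g X z"
      and X': "X' \<in> K" "G (-1) z = A X' / 2 + (-1) * g X' z" by metis
    have "G 1 z + G (-1) z \<le> (A X + A X') / 2 + \<bar>h X z - h X' z\<bar>"
      using dom[OF X(1) X'(1) z] X(2) X'(2) by (simp add: add_divide_distrib)
    also have "\<dots> \<le> (H 1 z + H (-1) z) / 2"
    proof -
      have "A Y + 2 * h Y z \<le> H 1 z" "A Y - 2 * h Y z \<le> H (-1) z" if "Y \<in> K" for Y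
        using H_ge[OF that, of 1 z] H_ge[OF that, of "-1" z] by auto
      from this[OF X(1)] this[OF X'(1)] show ?thesis
        by (cases "h X z \<le> h X' z") (simp_all add: field_simps)
    qed
    finally show ?thesis .
  qed
  have "measure_pmf.expectation p
      (\<lambda>z. MAX X\<in>K. A X + (measure_pmf.expectation p (g X) - g X z)) \<le>
      measure_pmf.expectation p (\<lambda>z. measure_pmf.expectation p (G 1) + G (-1) z)"
    using 1 by (intro expectation_mono_pmf fin)
  \<comment> \<open>Under the outer expectation the constant E (G 1) may be replaced by G 1 z at the
    same z, which couples the two terms.\<close>
  also have "\<dots> = measure_pmf.expectation p (\<lambda>z. G 1 z + G (-1) z)"
    by (simp add: Bochner_Integration.integral_add int)
  also have "\<dots> \<le> measure_pmf.expectation p (\<lambda>z. (H 1 z + H (-1) z) / 2)"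
    using 2 by (intro expectation_mono_pmf fin)
  also have "\<dots> = measure_pmf.expectation (pair_pmf p rademacher_pmf) (\<lambda>(z, e). H e z)"
    using fin by (simp add: expectation_pair_pmf_finite set_rademacher_pmf expectation_rademacher_pmf)
  finally show ?thesis unfolding H_def .
qed

text \<open>The arbitrary offset A is what makes the induction work: it carries the contribution of
  all samples other than the one being treated, whether these are still centred losses or already
  signed terms.\<close>

lemma symmetrization_contraction:
  fixes A :: "'k \<Rightarrow> real"
  assumes fin: "finite (set_pmf p)" and K: "finite K" "K \<noteq> {}" and I: "finite I"
    and dom: "\<And>X X' z. X \<in> K \<Longrightarrow> X' \<in> K \<Longrightarrow> z \<in> set_pmf p \<Longrightarrow>
      g X z - g X' z \<le> \<bar>h X z - h X' z\<bar>"
  shows "measure_pmf.expectation (Pi_pmf I dflt (\<lambda>_. p))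
      (\<lambda>z. MAX X\<in>K. A X + (\<Sum>i\<in>I. measure_pmf.expectation p (g X) - g X (z i))) \<le>
    measure_pmf.expectation (Pi_pmf I dflt' (\<lambda>_. pair_pmf p rademacher_pmf))
      (\<lambda>v. MAX X\<in>K. A X + (\<Sum>i\<in>I. 2 * snd (v i) * h X (fst (v i))))"
  using I
proof (induction I arbitrary: A)
  case empty
  then show ?case by simp
next
  case (insert i I)
  define r where "r = pair_pmf p rademacher_pmf"
  define P where "P = Pi_pmf I dflt (\<lambda>_. p)"
  define Q where "Q = Pi_pmf I dflt' (\<lambda>_. r)"
  define D where "D X y = measure_pmf.expectation p (g X) - g X y" for X y
  have finr: "finite (set_pmf r)"
    using fin by (simp add: r_def set_rademacher_pmf)
  have finP: "finite (set_pmf P)" and finQ: "finite (set_pmf Q)"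
    unfolding P_def Q_def using insert.hyps fin finr by (auto intro: finite_set_Pi_pmf)
  note upd = sum_insert_fun_upd[OF insert.hyps(1,2), where w = "D _"]
    sum_insert_fun_upd[OF insert.hyps(1,2), where w = "\<lambda>x. 2 * snd x * h _ (fst x)"]
  have "measure_pmf.expectation (Pi_pmf (insert i I) dflt (\<lambda>_. p))
      (\<lambda>z. MAX X\<in>K. A X + (\<Sum>j\<in>insert i I. D X (z j))) =
    measure_pmf.expectation p (\<lambda>y. measure_pmf.expectation P
      (\<lambda>z. MAX X\<in>K. A X + (\<Sum>j\<in>insert i I. D X ((z(i := y)) j))))"
    unfolding P_def by (rule expectation_Pi_pmf_insert[OF insert.hyps fin])
  also have "\<dots> = measure_pmf.expectation p (\<lambda>y. measure_pmf.expectation P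
      (\<lambda>z. MAX X\<in>K. (A X + D X y) + (\<Sum>j\<in>I. D X (z j))))"
    by (simp only: upd add.assoc)
  \<comment> \<open>Induction hypothesis with y fixed and offset A X + D X y.\<close>
  also have "\<dots> \<le> measure_pmf.expectation p (\<lambda>y. measure_pmf.expectation Q
      (\<lambda>v. MAX X\<in>K. (A X + D X y) + (\<Sum>j\<in>I. 2 * snd (v j) * h X (fst (v j)))))"
    unfolding P_def Q_def r_def D_def by (intro expectation_mono_pmf fin insert.IH)
  also have "\<dots> = measure_pmf.expectation Q (\<lambda>v. measure_pmf.expectation p
      (\<lambda>y. MAX X\<in>K. (A X + (\<Sum>j\<in>I. 2 * snd (v j) * h X (fst (v j)))) + D X y))"
    by (subst expectation_pmf_commute[OF fin finQ]) (simp only: ac_simps)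
  \<comment> \<open>Now v is fixed, and the signed sum over I joins the offset while sample i is
    symmetrized.\<close>
  also have "\<dots> \<le> measure_pmf.expectation Q (\<lambda>v. measure_pmf.expectation r (\<lambda>(y, e).
      MAX X\<in>K. (A X + (\<Sum>j\<in>I. 2 * snd (v j) * h X (fst (v j)))) + 2 * e * h X y))"
    unfolding r_def D_def
    by (intro expectation_mono_pmf finQ symmetrization_contraction_step fin K dom)
  also have "\<dots> = measure_pmf.expectation r (\<lambda>x. measure_pmf.expectation Q (\<lambda>v.
      MAX X\<in>K. A X + (2 * snd x * h X (fst x) + (\<Sum>j\<in>I. 2 * snd (v j) * h X (fst (v j))))))"
    by (subst expectation_pmf_commute[OF finQ finr]) (simp only: case_prod_unfold ac_simps)
  also have "\<dots> = measure_pmf.expectation r (\<lambda>x. measure_pmf.expectation Q (\<lambda>v.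
      MAX X\<in>K. A X + (\<Sum>j\<in>insert i I. 2 * snd ((v(i := x)) j) * h X (fst ((v(i := x)) j)))))"
    by (simp only: upd)
  also have "\<dots> = measure_pmf.expectation (Pi_pmf (insert i I) dflt' (\<lambda>_. r))
      (\<lambda>v. MAX X\<in>K. A X + (\<Sum>j\<in>insert i I. 2 * snd (v j) * h X (fst (v j))))"
    unfolding Q_def by (rule expectation_Pi_pmf_insert[OF insert.hyps finr, symmetric])
  finally show ?case unfolding D_def r_def .
qed

text \<open>The maximum is at most the logarithm of a sum of exponentials, divided by l. The
  parameter l stays free so that the caller can balance the two terms.\<close>

lemma expectation_Max_finite_class:
  fixes S :: "('a \<Rightarrow> real) set" and c l :: real
  assumes fin: "finite (set_pmf r)" and S: "finite S" "S \<noteq> {}" and I: "finite I" and l: "0 < l"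
    and mean: "\<And>s. s \<in> S \<Longrightarrow> measure_pmf.expectation r s = 0"
    and range: "\<And>s x y. s \<in> S \<Longrightarrow> x \<in> set_pmf r \<Longrightarrow> y \<in> set_pmf r \<Longrightarrow> s x - s y \<le> c"
  shows "measure_pmf.expectation (Pi_pmf I dflt (\<lambda>_. r)) (\<lambda>v. MAX s\<in>S. \<Sum>i\<in>I. s (v i)) \<le>
    ln (card S) / l + l * c\<^sup>2 * card I / 8"
proof -
  define P where "P = Pi_pmf I dflt (\<lambda>_. r)"
  define M where "M v = (MAX s\<in>S. \<Sum>i\<in>I. s (v i))" for v
  define k where "k = card S * exp (l\<^sup>2 * c\<^sup>2 / 8 * card I)"
  have card: "0 < card S" using S by (auto simp: card_gt_0_iff)
  have k: "0 < k" using card by (simp add: k_def)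
  have finP: "finite (set_pmf P)" unfolding P_def using I fin by (intro finite_set_Pi_pmf)
  have int: "integrable (measure_pmf P) \<phi>" for \<phi> :: "_ \<Rightarrow> real"
    by (rule integrable_measure_pmf_finite[OF finP])
  have mgf: "measure_pmf.expectation P (\<lambda>v. exp (l * (\<Sum>i\<in>I. s (v i)))) \<le>
      exp (l\<^sup>2 * c\<^sup>2 / 8 * card I)" if s: "s \<in> S" for s
  proof -
    have step: "measure_pmf.expectation r (\<lambda>x. exp (l * s x)) \<le> exp (l\<^sup>2 * c\<^sup>2 / 8)"
    proof -
      have "measure_pmf.expectation r (\<lambda>x. exp (l * s x)) \<le>
          exp (l * measure_pmf.expectation r s + l\<^sup>2 * c\<^sup>2 / 8)"
        by (rule mgf_bounded_range[OF fin l range[OF s]])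
      then show ?thesis by (simp add: mean[OF s])
    qed
    have "measure_pmf.expectation P (\<lambda>v. exp (l * (\<Sum>i\<in>I. s (v i)))) =
        measure_pmf.expectation P (\<lambda>v. \<Prod>i\<in>I. exp (l * s (v i)))"
      using I by (simp add: sum_distrib_left exp_sum)
    also have "\<dots> = (\<Prod>i\<in>I. measure_pmf.expectation r (\<lambda>x. exp (l * s x)))"
      unfolding P_def using I fin
      by (intro expectation_prod_Pi_pmf) (auto intro: integrable_measure_pmf_finite)
    also have "\<dots> \<le> (\<Prod>i\<in>I. exp (l\<^sup>2 * c\<^sup>2 / 8))"
      using step by (intro prod_mono) (auto intro: Bochner_Integration.integral_nonneg)
    finally show ?thesis by (simp add: mult.commute flip: exp_of_nat_mult)
  qed
  \<comment> \<open>The tangent line of ln at k stands in for Jensen's inequality. Since k bounds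
    the expected sum of exponentials, the first term contributes at most 1 and cancels the
    -1.\<close>
  have M: "l * M v \<le> (\<Sum>s\<in>S. exp (l * (\<Sum>i\<in>I. s (v i)))) / k + (ln k - 1)" for v
  proof -
    obtain s where s: "s \<in> S" "M v = (\<Sum>i\<in>I. s (v i))"
      using Max_image_attained[OF S] unfolding M_def by blast
    have "exp (l * M v) \<le> (\<Sum>s\<in>S. exp (l * (\<Sum>i\<in>I. s (v i))))"
      unfolding s(2) using s(1) S(1) by (intro member_le_sum) auto
    moreover have "ln (exp (l * M v) / k) \<le> exp (l * M v) / k - 1"
      using k by (intro ln_le_minus_one) auto
    then have "l * M v \<le> exp (l * M v) / k + (ln k - 1)"
      using k by (simp add: ln_div)
    ultimately show ?thesis
      using k by (smt (verit) divide_right_mono)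
  qed
  have "l * measure_pmf.expectation P M = measure_pmf.expectation P (\<lambda>v. l * M v)"
    by simp
  also have "\<dots> \<le> measure_pmf.expectation P
      (\<lambda>v. (\<Sum>s\<in>S. exp (l * (\<Sum>i\<in>I. s (v i)))) / k + (ln k - 1))"
    using M by (intro expectation_mono_pmf finP)
  also have "\<dots> = (\<Sum>s\<in>S. measure_pmf.expectation P (\<lambda>v. exp (l * (\<Sum>i\<in>I. s (v i))))) / k + (ln k - 1)"
    by (simp add: Bochner_Integration.integral_add Bochner_Integration.integral_sum int)
  also have "\<dots> \<le> (\<Sum>s\<in>S. exp (l\<^sup>2 * c\<^sup>2 / 8 * card I)) / k + (ln k - 1)"
    using mgf k by (intro add_right_mono divide_right_mono sum_mono) auto
  also have "\<dots> = ln k"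
    using card by (simp add: k_def)
  also have "\<dots> = ln (card S) + l\<^sup>2 * c\<^sup>2 / 8 * card I"
    using card by (simp add: k_def ln_mult)
  finally have "measure_pmf.expectation P M \<le> (ln (card S) + l\<^sup>2 * c\<^sup>2 / 8 * card I) / l"
    using l by (simp add: field_simps)
  also have "\<dots> = ln (card S) / l + l * c\<^sup>2 * card I / 8"
    using l by (simp add: field_simps power2_eq_square)
  finally show ?thesis unfolding P_def M_def .
qed

section \<open>Link functions\<close>

lemma mult_cos_le_sin:
  fixes v :: real
  assumes "0 \<le> v" "v \<le> pi"
  shows "v * cos v \<le> sin v"
proof -
  have "sin 0 - 0 * cos 0 \<le> sin v - v * cos v"
  proof (rule DERIV_nonneg_imp_nondecreasing[OF assms(1)])
    fix x :: real assume "0 \<le> x" "x \<le> v"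
    moreover have "((\<lambda>x. sin x - x * cos x) has_real_derivative x * sin x) (at x)"
      by (auto intro!: derivative_eq_intros simp: algebra_simps)
    ultimately show "\<exists>y. ((\<lambda>x. sin x - x * cos x) has_real_derivative y) (at x) \<and> 0 \<le> y"
      using assms by (intro exI[of _ "x * sin x"]) (auto intro!: mult_nonneg_nonneg sin_ge_zero)
  qed
  then show ?thesis by simp
qed

text \<open>Write 1 - cos u = 2 sin(v)^2 with v = |u|/2. As v is at most pi/4, sin v >= v cos v >= v
  sqrt(2)/2. The range of u is that of a difference of two angles in [0, pi/2].\<close>

lemma quadratic_le_one_minus_cos:
  fixes u :: real
  assumes "\<bar>u\<bar> \<le> pi / 2"
  shows "u\<^sup>2 / 4 \<le> 1 - cos u"
proof -
  define v where "v = \<bar>u\<bar> / 2"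
  have v: "0 \<le> v" "v \<le> pi / 4" using assms by (auto simp: v_def)
  have "cos (pi / 4) \<le> cos v"
    using v by (intro cos_monotone_0_pi_le) auto
  then have "sqrt 2 / 2 \<le> cos v"
    by (simp add: cos_45)
  then have "v * (sqrt 2 / 2) \<le> v * cos v"
    using v by (intro mult_left_mono)
  also have "\<dots> \<le> sin v"
    using v pi_gt_zero by (intro mult_cos_le_sin) auto
  finally have "(v * (sqrt 2 / 2))\<^sup>2 \<le> (sin v)\<^sup>2"
    using v by (intro power_mono) auto
  then have "v\<^sup>2 / 2 \<le> (sin v)\<^sup>2"
    by (simp add: power_mult_distrib power_divide)
  moreover have "cos u = 1 - 2 * (sin v)\<^sup>2"
    using cos_double_sin[of v] by (simp add: v_def)
  moreover have "u\<^sup>2 = 4 * v\<^sup>2"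
    by (simp add: v_def power_divide)
  ultimately show ?thesis by simp
qed

text \<open>
  The map $p \mapsto \arcsin \sqrt p$ turns the Hellinger affinity
  $\sqrt{pq} + \sqrt{(1-p)(1-q)}$ into the cosine of a difference of angles.
\<close>
lemma bernoulli_KL_ge_angle:
  fixes p q :: real
  assumes p: "0 < p" "p < 1" and q: "0 < q" "q < 1"
  shows "(arcsin (sqrt p) - arcsin (sqrt q))\<^sup>2 / 2 \<le>
    p * ln (p / q) + (1 - p) * ln ((1 - p) / (1 - q))"
proof -
  \<comment> \<open>Applied to (p, q) and (1 - p, 1 - q) and added, this bounds the divergence below
    by twice (1 - affinity), the square-root form of ln x <= x - 1.\<close>
  have ln_ge: "2 * (a - sqrt (a * b)) \<le> a * ln (a / b)" if "0 < a" "0 < b" for a b :: real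
  proof -
    have "ln (sqrt (b / a)) \<le> sqrt (b / a) - 1"
      using that by (intro ln_le_minus_one) auto
    then have "2 * (1 - sqrt (b / a)) \<le> ln (a / b)"
      using that by (simp add: ln_sqrt ln_div)
    then have "a * (2 * (1 - sqrt (b / a))) \<le> a * ln (a / b)"
      using that by (intro mult_left_mono) auto
    moreover have "a * sqrt (b / a) = sqrt (a * b)"
      using that by (simp add: real_sqrt_divide real_sqrt_mult field_simps)
    ultimately show ?thesis by (simp add: algebra_simps)
  qed
  define s t where "s = arcsin (sqrt p)" and "t = arcsin (sqrt q)"
  have range: "0 \<le> arcsin (sqrt x) \<and> arcsin (sqrt x) \<le> pi / 2" if "0 < x" "x < 1" for x
  proof -
    have "0 \<le> sqrt x" using that by simp
    then have "-1 \<le> sqrt x" by linarith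
    then show ?thesis
      using that arcsin_le_mono[of 0 "sqrt x"] arcsin_bounded[of "sqrt x"] by auto
  qed
  have sin: "sin (arcsin (sqrt x)) = sqrt x" if "0 < x" "x < 1" for x
    using that by (intro arcsin_sin sin_arcsin) (auto intro: order_trans[of _ 0])
  have cos: "cos (arcsin (sqrt x)) = sqrt (1 - x)" if "0 < x" "x < 1" for x
    using that by (subst cos_arcsin) (auto intro: order_trans[of _ 0])
  have "\<bar>s - t\<bar> \<le> pi / 2"
    unfolding abs_le_iff s_def t_def using range[OF p] range[OF q] by linarith
  then have "(s - t)\<^sup>2 / 4 \<le> 1 - cos (s - t)"
    by (rule quadratic_le_one_minus_cos)
  also have "cos (s - t) = sqrt (p * q) + sqrt ((1 - p) * (1 - q))"
    using p q by (simp add: cos_diff sin cos s_def t_def real_sqrt_mult)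
  finally show ?thesis
    using ln_ge[of p q] ln_ge[of "1 - p" "1 - q"] p q by (simp add: s_def t_def algebra_simps)
qed

section \<open>What the constants L, \<beta> and U say about the link function\<close>

context
  fixes \<alpha> :: real and f :: "real \<Rightarrow> real"
  assumes link: "admissible_link \<alpha> f" and \<alpha>: "0 < \<alpha>"
begin

lemma link_has_real_derivative: "(f has_real_derivative deriv f x) (at x)"
  using link unfolding admissible_link_def
  by (auto simp: DERIV_deriv_iff_real_differentiable differentiable_on_def)

lemma link_pos: "x \<in> {-\<alpha>..\<alpha>} \<Longrightarrow> 0 < f x"
  using link unfolding admissible_link_def by (auto simp: less_le)

lemma link_less_one:
  assumes "x \<in> {-\<alpha>..\<alpha>}"
  shows "f x < 1"
proof -
  have "f x \<noteq> 1"
  proof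
    assume "f x = 1"
    then have "\<forall>y. \<bar>x - y\<bar> < 1 \<longrightarrow> f y \<le> f x"
      using link by (auto simp: admissible_link_def)
    then have "deriv f x = 0"
      by (rule DERIV_local_max[OF link_has_real_derivative zero_less_one])
    then show False using link assms by (auto simp: admissible_link_def)
  qed
  then show ?thesis using link by (auto simp: admissible_link_def less_le)
qed

lemma deriv_le_L_const:
  assumes x: "x \<in> {-\<alpha>..\<alpha>}"
  shows "\<bar>deriv f x\<bar> \<le> L_const \<alpha> f * (f x * (1 - f x))"
proof -
  have "\<bar>deriv f x\<bar> / (f x * (1 - f x)) \<le> L_const \<alpha> f"
    unfolding L_const_def using link x by (intro cSUP_upper) (auto simp: admissible_link_def)
  then show ?thesis
    using link_pos[OF x] link_less_one[OF x] by (simp add: pos_divide_le_eq)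
qed

lemma variance_le_beta_const:
  assumes x: "x \<in> {-\<alpha>..\<alpha>}"
  shows "f x * (1 - f x) \<le> \<beta>_const \<alpha> f * (deriv f x)\<^sup>2"
proof -
  have "f x * (1 - f x) / (deriv f x)\<^sup>2 \<le> \<beta>_const \<alpha> f"
    unfolding \<beta>_const_def using link x by (intro cSUP_upper) (auto simp: admissible_link_def)
  moreover have "deriv f x \<noteq> 0" using link x by (auto simp: admissible_link_def)
  ultimately show ?thesis by (simp add: pos_divide_le_eq)
qed

lemma L_const_nonneg: "0 \<le> L_const \<alpha> f"
proof -
  have "0 \<le> L_const \<alpha> f * (f 0 * (1 - f 0))"
    using deriv_le_L_const[of 0] \<alpha> by (auto intro: order_trans[OF abs_ge_zero])
  moreover have "0 < f 0 * (1 - f 0)"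
    using link_pos[of 0] link_less_one[of 0] \<alpha> by simp
  ultimately show ?thesis by (metis zero_le_mult_iff not_le)
qed

lemma beta_const_pos: "0 < \<beta>_const \<alpha> f"
proof -
  have "0 < f 0 * (1 - f 0)" using link_pos[of 0] link_less_one[of 0] \<alpha> by simp
  also have "\<dots> \<le> \<beta>_const \<alpha> f * (deriv f 0)\<^sup>2"
    using \<alpha> by (intro variance_le_beta_const) auto
  finally show ?thesis by (simp add: zero_less_mult_iff)
qed

text \<open>U bounds the sum of the two negative logarithms; both are nonnegative, so it bounds each
  of them.\<close>

lemma neg_ln_link_bounds:
  assumes x: "x \<in> {-\<alpha>..\<alpha>}"
  shows "0 \<le> - ln (f x)" "- ln (f x) \<le> U_const \<alpha> f"
    "0 \<le> - ln (1 - f x)" "- ln (1 - f x) \<le> U_const \<alpha> f"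
proof -
  have "ln (1 / (f x * (1 - f x))) \<le> U_const \<alpha> f"
    unfolding U_const_def using link x by (intro cSUP_upper) (auto simp: admissible_link_def)
  then have "- ln (f x) - ln (1 - f x) \<le> U_const \<alpha> f"
    using link_pos[OF x] link_less_one[OF x] by (simp add: ln_div ln_mult)
  moreover show "0 \<le> - ln (f x)" "0 \<le> - ln (1 - f x)"
    using link_pos[OF x] link_less_one[OF x] by auto
  ultimately show "- ln (f x) \<le> U_const \<alpha> f" "- ln (1 - f x) \<le> U_const \<alpha> f" by auto
qed

lemma U_const_pos: "0 < U_const \<alpha> f"
proof -
  have "0 < - ln (f 0)" using link_pos[of 0] link_less_one[of 0] \<alpha> by simp
  also have "\<dots> \<le> U_const \<alpha> f" using neg_ln_link_bounds[of 0] \<alpha> by simp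
  finally show ?thesis .
qed

text \<open>The derivatives are f'/f and -f'/(1 - f). Both are bounded by L, because each
  denominator is at least f (1 - f).\<close>

lemma neg_ln_link_lipschitz:
  assumes x: "x \<in> {-\<alpha>..\<alpha>}" and y: "y \<in> {-\<alpha>..\<alpha>}"
  shows "\<bar>ln (f x) - ln (f y)\<bar> \<le> L_const \<alpha> f * \<bar>x - y\<bar>"
    and "\<bar>ln (1 - f x) - ln (1 - f y)\<bar> \<le> L_const \<alpha> f * \<bar>x - y\<bar>"
proof -
  have bound: "\<bar>deriv f z / f z\<bar> \<le> L_const \<alpha> f" "\<bar>- deriv f z / (1 - f z)\<bar> \<le> L_const \<alpha> f"
    if z: "z \<in> {-\<alpha>..\<alpha>}" for z
  proof -
    note f = link_pos[OF z] link_less_one[OF z]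
    have "L_const \<alpha> f * (f z * (1 - f z)) \<le> L_const \<alpha> f * f z"
      "L_const \<alpha> f * (f z * (1 - f z)) \<le> L_const \<alpha> f * (1 - f z)"
      using f by (auto intro!: mult_left_mono[OF _ L_const_nonneg] simp: mult_left_le mult_left_le_one_le)
    then show "\<bar>deriv f z / f z\<bar> \<le> L_const \<alpha> f" "\<bar>- deriv f z / (1 - f z)\<bar> \<le> L_const \<alpha> f"
      using deriv_le_L_const[OF z] f by (auto simp: abs_divide pos_divide_le_eq)
  qed
  have "norm (ln (f x) - ln (f y)) \<le> L_const \<alpha> f * norm (x - y)"
  proof (rule field_differentiable_bound[where f' = "\<lambda>z. deriv f z / f z" and S = "{-\<alpha>..\<alpha>}"])
    fix z assume "z \<in> {-\<alpha>..\<alpha>}"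
    then show "((\<lambda>z. ln (f z)) has_real_derivative deriv f z / f z) (at z within {-\<alpha>..\<alpha>})"
      using link_pos by - (rule has_field_derivative_at_within,
        auto intro!: derivative_eq_intros link_has_real_derivative)
  qed (use bound x y in auto)
  then show "\<bar>ln (f x) - ln (f y)\<bar> \<le> L_const \<alpha> f * \<bar>x - y\<bar>" by simp
  have "norm (ln (1 - f x) - ln (1 - f y)) \<le> L_const \<alpha> f * norm (x - y)"
  proof (rule field_differentiable_bound[where f' = "\<lambda>z. - deriv f z / (1 - f z)" and S = "{-\<alpha>..\<alpha>}"])
    fix z assume "z \<in> {-\<alpha>..\<alpha>}"
    then show "((\<lambda>z. ln (1 - f z)) has_real_derivative - deriv f z / (1 - f z)) (at z within {-\<alpha>..\<alpha>})"
      using link_less_one by - (rule has_field_derivative_at_within,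
        auto intro!: derivative_eq_intros link_has_real_derivative)
  qed (use bound x y in auto)
  then show "\<bar>ln (1 - f x) - ln (1 - f y)\<bar> \<le> L_const \<alpha> f * \<bar>x - y\<bar>" by simp
qed

lemma link_angle_separation:
  assumes x: "x \<in> {-\<alpha>..\<alpha>}" and y: "y \<in> {-\<alpha>..\<alpha>}"
  shows "(x - y)\<^sup>2 \<le> 4 * \<beta>_const \<alpha> f * (arcsin (sqrt (f x)) - arcsin (sqrt (f y)))\<^sup>2"
  using x y
proof (induction x y rule: linorder_wlog)
  case (sym x y)
  then show ?case by (simp add: power2_commute)
next
  case (le x y)
  show ?case
  proof (cases "x = y")
    case False
    define D where "D z = deriv f z / (2 * sqrt (f z) * sqrt (1 - f z))" for z
    have deriv: "((\<lambda>z. arcsin (sqrt (f z))) has_real_derivative D z) (at z)" if z: "z \<in> {-\<alpha>..\<alpha>}" for z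
    proof -
      note f = link_pos[OF z] link_less_one[OF z]
      have "0 < sqrt (f z)" using f by simp
      then have "-1 < sqrt (f z)" by linarith
      then have "(arcsin has_real_derivative inverse (sqrt (1 - (sqrt (f z))\<^sup>2))) (at (sqrt (f z)))"
        using f by (intro DERIV_arcsin) auto
      moreover have "((\<lambda>z. sqrt (f z)) has_real_derivative inverse (sqrt (f z)) / 2 * deriv f z) (at z)"
        using f by (intro DERIV_chain2[OF DERIV_real_sqrt link_has_real_derivative])
      ultimately have "((\<lambda>z. arcsin (sqrt (f z))) has_real_derivative
          inverse (sqrt (1 - (sqrt (f z))\<^sup>2)) * (inverse (sqrt (f z)) / 2 * deriv f z)) (at z)"
        by (rule DERIV_chain2)
      moreover have "inverse (sqrt (1 - (sqrt (f z))\<^sup>2)) * (inverse (sqrt (f z)) / 2 * deriv f z) = D z"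
        using f by (simp add: D_def field_simps)
      ultimately show ?thesis by simp
    qed
    obtain z where z: "x < z" "z < y"
      "arcsin (sqrt (f y)) - arcsin (sqrt (f x)) = (y - x) * D z"
      using MVT2[of x y "\<lambda>z. arcsin (sqrt (f z))" D] deriv le False by auto
    have zI: "z \<in> {-\<alpha>..\<alpha>}" using z le by auto
    have "1 \<le> \<beta>_const \<alpha> f * ((deriv f z)\<^sup>2 / (f z * (1 - f z)))"
      using variance_le_beta_const[OF zI] link_pos[OF zI] link_less_one[OF zI]
      by (simp add: pos_le_divide_eq)
    also have "\<dots> = 4 * \<beta>_const \<alpha> f * (D z)\<^sup>2"
      using link_pos[OF zI] link_less_one[OF zI]
      by (simp add: D_def power_divide power_mult_distrib)
    finally have "(y - x)\<^sup>2 * 1 \<le> (y - x)\<^sup>2 * (4 * \<beta>_const \<alpha> f * (D z)\<^sup>2)"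
      by (intro mult_left_mono) auto
    also have "\<dots> = 4 * \<beta>_const \<alpha> f * (arcsin (sqrt (f y)) - arcsin (sqrt (f x)))\<^sup>2"
      by (simp add: z(3) power_mult_distrib)
    finally show ?thesis by (simp add: power2_commute)
  qed simp
qed

text \<open>The 8 is the 4 of \<open>link_angle_separation\<close> times the 2 lost in
  \<open>bernoulli_KL_ge_angle\<close>.\<close>

lemma link_KL_ge:
  assumes x: "x \<in> {-\<alpha>..\<alpha>}" and y: "y \<in> {-\<alpha>..\<alpha>}"
  shows "(x - y)\<^sup>2 \<le> 8 * \<beta>_const \<alpha> f *
    (f x * (ln (f x) - ln (f y)) + (1 - f x) * (ln (1 - f x) - ln (1 - f y)))"
proof -
  note f = link_pos[OF x] link_less_one[OF x] link_pos[OF y] link_less_one[OF y]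
  define A where "A = (arcsin (sqrt (f x)) - arcsin (sqrt (f y)))\<^sup>2"
  define KL where "KL = f x * (ln (f x) - ln (f y)) + (1 - f x) * (ln (1 - f x) - ln (1 - f y))"
  have "A / 2 \<le> KL"
    using bernoulli_KL_ge_angle[OF f] f by (simp add: A_def KL_def ln_div)
  then have "8 * \<beta>_const \<alpha> f * (A / 2) \<le> 8 * \<beta>_const \<alpha> f * KL"
    using beta_const_pos by (intro mult_left_mono) auto
  with link_angle_separation[OF x y] show ?thesis
    by (simp add: A_def KL_def)
qed

end

section \<open>Tensors and the M-norm\<close>

lemma entry_scaleR [simp]: "entry (c *\<^sub>R T) \<omega> = c * entry T \<omega>"
  unfolding scaleR_poly_mapping_def
  by (subst lookup_Abs_poly_mapping) (auto intro: finite_subset[OF _ finite_lookup[of T]])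

lemma finite_indices: "finite (indices N d)"
  by (simp add: indices_def finite_PiE)

lemma indices_nonempty: "1 \<le> N \<Longrightarrow> indices N d \<noteq> {}"
  by (simp add: indices_def PiE_eq_empty_iff)

lemma entry_outside: "T \<in> tensors N d \<Longrightarrow> \<omega> \<notin> indices N d \<Longrightarrow> entry T \<omega> = 0"
  by (auto simp: tensors_def in_keys_iff)

text \<open>Covers every \<omega>, also outside [N]^d where entries vanish, because the bounded
  differences inequality varies a sample over all values of its type.\<close>

lemma abs_entry_le:
  assumes "T \<in> tensors N d" "entry_max_norm N d T \<le> \<alpha>" "0 \<le> \<alpha>"
  shows "\<bar>entry T \<omega>\<bar> \<le> \<alpha>"
proof (cases "\<omega> \<in> indices N d")
  case True
  then have "\<bar>entry T \<omega>\<bar> \<le> entry_max_norm N d T"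
    unfolding entry_max_norm_def by (intro Max_ge) (auto simp: finite_indices)
  with assms show ?thesis by simp
qed (use assms entry_outside in auto)

definition tensor_of :: "nat \<Rightarrow> nat \<Rightarrow> (tensor_index \<Rightarrow> real) \<Rightarrow> tensor" where
  "tensor_of N d h = (\<Sum>\<omega>\<in>indices N d. Poly_Mapping.single \<omega> (h \<omega>))"

lemma entry_tensor_of: "entry (tensor_of N d h) \<omega> = (if \<omega> \<in> indices N d then h \<omega> else 0)"
  by (simp add: tensor_of_def lookup_sum lookup_single finite_indices when_def)

lemma tensor_of_in_tensors: "tensor_of N d h \<in> tensors N d"
  by (auto simp: tensors_def in_keys_iff entry_tensor_of split: if_splits)

lemma tensor_of_sign_rank_one:
  assumes "1 \<le> N" and v: "\<And>j i. v j i \<in> {-1, 1 :: real}"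
  shows "tensor_of N d (\<lambda>\<omega>. \<Prod>j\<in>{1..d}. v j (\<omega> j)) \<in> sign_rank_one N d"
proof -
  let ?T = "tensor_of N d (\<lambda>\<omega>. \<Prod>j\<in>{1..d}. v j (\<omega> j))"
  have prod: "(\<Prod>j\<in>J. v j (\<omega> j)) \<in> {-1, 1}" if "finite J" for J \<omega>
    using that by (induction J) (use v in force)+
  obtain \<omega> where \<omega>: "\<omega> \<in> indices N d" using indices_nonempty[OF assms(1)] by blast
  have "?T \<noteq> 0"
  proof
    assume "?T = 0"
    then have "entry ?T \<omega> = 0" by simp
    then have "(\<Prod>j\<in>{1..d}. v j (\<omega> j)) = 0" using \<omega> by (simp only: entry_tensor_of if_True)
    with prod[OF finite_atLeastAtMost, of \<omega> 1 d] show False by (simp only: insert_iff) simp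
  qed
  moreover have "\<forall>\<omega>\<in>indices N d. entry ?T \<omega> \<in> {-1, 1}"
    using prod[OF finite_atLeastAtMost] by (simp add: entry_tensor_of)
  moreover have "\<forall>\<omega>\<in>indices N d. entry ?T \<omega> = (\<Prod>j\<in>{1..d}. v j (\<omega> j))"
    by (simp add: entry_tensor_of)
  ultimately show ?thesis
    unfolding sign_rank_one_def rank_one_def using tensor_of_in_tensors by blast
qed

lemma sign_rank_one_nonempty: "1 \<le> N \<Longrightarrow> sign_rank_one N d \<noteq> {}"
  using tensor_of_sign_rank_one[of N "\<lambda>_ _. 1" d] by auto

lemma sign_rank_one_abs_entry:
  "S \<in> sign_rank_one N d \<Longrightarrow> \<omega> \<in> indices N d \<Longrightarrow> \<bar>entry S \<omega>\<bar> = 1"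
  by (auto simp: sign_rank_one_def)

text \<open>The sign is absorbed by the first factor. For d = 0 there is no factor to flip and the
  entry is the empty product 1.\<close>

lemma sign_rank_one_uminus:
  assumes S: "S \<in> sign_rank_one N d" and d: "1 \<le> d"
  shows "- S \<in> sign_rank_one N d"
proof -
  obtain v :: "nat \<Rightarrow> nat \<Rightarrow> real"
    where v: "\<forall>\<omega>\<in>indices N d. entry S \<omega> = (\<Prod>j\<in>{1..d}. v j (\<omega> j))"
    using S by (auto simp: sign_rank_one_def rank_one_def)
  define w where "w j i = (if j = 1 then - v j i else v j i)" for j i
  have "(\<Prod>j\<in>{1..d}. w j (\<omega> j)) = - (\<Prod>j\<in>{1..d}. v j (\<omega> j))" for \<omega>
  proof -
    have "{1..d} = insert 1 {2..d}" using d by auto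
    moreover have "(\<Prod>j\<in>{2..d}. w j (\<omega> j)) = (\<Prod>j\<in>{2..d}. v j (\<omega> j))"
      by (intro prod.cong) (auto simp: w_def)
    ultimately show ?thesis by (simp add: w_def)
  qed
  then have "\<forall>\<omega>\<in>indices N d. entry (- S) \<omega> = (\<Prod>j\<in>{1..d}. w j (\<omega> j))"
    using v by simp
  moreover have "- S \<in> tensors N d" "- S \<noteq> 0" "\<forall>\<omega>\<in>indices N d. entry (- S) \<omega> \<in> {-1, 1}"
    using S by (auto simp: sign_rank_one_def rank_one_def tensors_def)
  ultimately show ?thesis
    unfolding sign_rank_one_def rank_one_def by blast
qed

text \<open>The factors of a sign tensor need not be signs themselves, but replacing each by its
  \<open>sgn\<close> leaves the products unchanged. Admitting the value 0 avoids showing that the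
  factors are nonzero, at the price of the base 3 in the count.\<close>

lemma sign_rank_one_subset_image:
  "sign_rank_one N d \<subseteq>
    (\<lambda>s. tensor_of N d (\<lambda>\<omega>. \<Prod>j\<in>{1..d}. s (j, \<omega> j))) ` (({1..d} \<times> {1..N}) \<rightarrow>\<^sub>E {-1, 0, 1 :: real})"
proof
  fix S assume S: "S \<in> sign_rank_one N d"
  obtain v :: "nat \<Rightarrow> nat \<Rightarrow> real"
    where v: "\<forall>\<omega>\<in>indices N d. entry S \<omega> = (\<Prod>j\<in>{1..d}. v j (\<omega> j))"
    using S by (auto simp: sign_rank_one_def rank_one_def)
  define s where "s = restrict (\<lambda>(j, i). sgn (v j i)) ({1..d} \<times> {1..N})"
  have sgn_prod: "sgn (\<Prod>j\<in>J. u j) = (\<Prod>j\<in>J. sgn (u j))" for J :: "nat set" and u :: "nat \<Rightarrow> real"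
    by (induction J rule: infinite_finite_induct) (auto simp: sgn_mult)
  have "S = tensor_of N d (\<lambda>\<omega>. \<Prod>j\<in>{1..d}. s (j, \<omega> j))"
  proof (rule poly_mapping_eqI)
    fix \<omega>
    show "entry S \<omega> = entry (tensor_of N d (\<lambda>\<omega>. \<Prod>j\<in>{1..d}. s (j, \<omega> j))) \<omega>"
    proof (cases "\<omega> \<in> indices N d")
      case True
      then have "entry S \<omega> = sgn (entry S \<omega>)"
        using S by (auto simp: sign_rank_one_def)
      also have "\<dots> = (\<Prod>j\<in>{1..d}. sgn (v j (\<omega> j)))"
        using v True by (simp add: sgn_prod)
      also have "\<dots> = (\<Prod>j\<in>{1..d}. s (j, \<omega> j))"
        using True by (intro prod.cong) (auto simp: s_def indices_def)
      finally show ?thesis using True by (simp add: entry_tensor_of)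
    next
      case False
      with S show ?thesis
        by (auto simp: entry_tensor_of entry_outside sign_rank_one_def rank_one_def)
    qed
  qed
  moreover have "s \<in> ({1..d} \<times> {1..N}) \<rightarrow>\<^sub>E {-1, 0, 1}"
    by (auto simp: s_def sgn_real_def split: if_splits)
  ultimately show "S \<in> (\<lambda>s. tensor_of N d (\<lambda>\<omega>. \<Prod>j\<in>{1..d}. s (j, \<omega> j))) `
      (({1..d} \<times> {1..N}) \<rightarrow>\<^sub>E {-1, 0, 1 :: real})"
    by blast
qed

lemma finite_sign_rank_one: "finite (sign_rank_one N d)"
  by (rule finite_subset[OF sign_rank_one_subset_image]) (auto intro: finite_PiE)

lemma card_sign_rank_one: "card (sign_rank_one N d) \<le> 3 ^ (d * N)"
proof -
  have "card (sign_rank_one N d) \<le> card (({1..d} \<times> {1..N}) \<rightarrow>\<^sub>E {-1, 0, 1 :: real})"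
    by (rule surj_card_le[OF _ sign_rank_one_subset_image]) (auto intro: finite_PiE)
  also have "\<dots> = 3 ^ (d * N)"
    by (simp add: card_PiE card_cartesian_product numeral_3_eq_3)
  finally show ?thesis .
qed

section \<open>The M-norm as the gauge of the hull of the sign tensors\<close>

text \<open>Reduces the question whether every tensor lies in some dilate of the hull to a question
  about spanning. For sums, s a + t b is s + t times a convex combination of a and b; symmetry
  handles negative scalars.\<close>

lemma subspace_cone_symmetric_convex:
  fixes C :: "'a::real_vector set"
  assumes "convex C" "0 \<in> C" and sym: "\<And>x. x \<in> C \<Longrightarrow> - x \<in> C"
  shows "subspace {x. \<exists>t>0. x \<in> (\<lambda>y. t *\<^sub>R y) ` C}"
proof (rule subspaceI)
  show "0 \<in> {x. \<exists>t>0. x \<in> (\<lambda>y. t *\<^sub>R y) ` C}"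
    using \<open>0 \<in> C\<close> by (auto intro!: exI[of _ 1] image_eqI[of _ _ 0])
next
  fix x y assume "x \<in> {x. \<exists>t>0. x \<in> (\<lambda>y. t *\<^sub>R y) ` C}" "y \<in> {x. \<exists>t>0. x \<in> (\<lambda>y. t *\<^sub>R y) ` C}"
  then obtain s t a b where x: "0 < s" "a \<in> C" "x = s *\<^sub>R a" and y: "0 < t" "b \<in> C" "y = t *\<^sub>R b"
    by auto
  have "(s / (s + t)) *\<^sub>R a + (t / (s + t)) *\<^sub>R b \<in> C"
    using \<open>convex C\<close> x y by (intro convexD) (auto simp flip: add_divide_distrib)
  moreover have "x + y = (s + t) *\<^sub>R ((s / (s + t)) *\<^sub>R a + (t / (s + t)) *\<^sub>R b)"
    using x y by (simp add: scaleR_add_right)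
  ultimately show "x + y \<in> {x. \<exists>t>0. x \<in> (\<lambda>y. t *\<^sub>R y) ` C}"
    using x(1) y(1) by (auto intro!: exI[of _ "s + t"])
next
  fix c :: real and x assume "x \<in> {x. \<exists>t>0. x \<in> (\<lambda>y. t *\<^sub>R y) ` C}"
  then obtain t a where x: "0 < t" "a \<in> C" "x = t *\<^sub>R a" by auto
  consider "c = 0" | "0 < c" | "c < 0" by linarith
  then show "c *\<^sub>R x \<in> {x. \<exists>t>0. x \<in> (\<lambda>y. t *\<^sub>R y) ` C}"
  proof cases
    case 1
    then show ?thesis using \<open>0 \<in> C\<close> by (auto intro!: exI[of _ 1] image_eqI[of _ _ 0])
  next
    case 2
    then show ?thesis using x by (auto intro!: exI[of _ "c * t"])
  next
    case 3
    then have "0 < - c * t" "c *\<^sub>R x = (- c * t) *\<^sub>R (- a)"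
      using x by (auto simp: mult_neg_pos)
    then show ?thesis using sym[OF x(2)] by blast
  qed
qed

lemma convex_hull_uminus:
  fixes S :: "'a::real_vector set"
  assumes "\<And>x. x \<in> S \<Longrightarrow> - x \<in> S" "x \<in> convex hull S"
  shows "- x \<in> convex hull S"
proof -
  have "uminus ` (convex hull S) = convex hull (uminus ` S)"
    by (intro convex_hull_linear_image linearI) auto
  also have "\<dots> \<subseteq> convex hull S"
    using assms(1) by (intro hull_mono) auto
  finally show ?thesis using assms(2) by auto
qed

text \<open>Makes the infimum in \<open>M_norm\<close> meaningful, since \<open>Inf\<close> of the
  empty set of reals carries no information. By the subspace property it is enough to reach the unit
  tensors.\<close>

lemma M_norm_set_nonempty:
  assumes T: "T \<in> tensors N d" and N: "1 \<le> N" and d: "1 \<le> d"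
  shows "\<exists>t>0. T \<in> (\<lambda>X. t *\<^sub>R X) ` (convex hull sign_rank_one N d)"
proof -
  let ?C = "convex hull sign_rank_one N d"
  define G where "G = {X. \<exists>t>0. X \<in> (\<lambda>X. t *\<^sub>R X) ` ?C}"
  have sym: "- x \<in> ?C" if "x \<in> ?C" for x
    by (rule convex_hull_uminus[OF sign_rank_one_uminus[OF _ d] that])
  obtain S where "S \<in> sign_rank_one N d" using sign_rank_one_nonempty[OF N] by blast
  then have "S \<in> ?C" by (rule hull_inc)
  then have "(1 / 2) *\<^sub>R S + (1 / 2) *\<^sub>R (- S) \<in> ?C"
    using sym by (intro convexD[OF convex_convex_hull]) auto
  then have "0 \<in> ?C" by simp
  then have sub: "subspace G"
    unfolding G_def using sym by (intro subspace_cone_symmetric_convex convex_convex_hull)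
  have sign: "S \<in> G" if "S \<in> sign_rank_one N d" for S
    unfolding G_def using that by (auto intro!: exI[of _ 1] simp: hull_inc)
  have single: "tensor_of N d (\<lambda>\<omega>. if \<omega> = \<rho> then 1 else 0) \<in> G" if \<rho>: "\<rho> \<in> indices N d" for \<rho>
  proof -
    \<comment> \<open>The indicator of \<rho> is the product over j of (1 + u j) / 2, where u j is 1
      if \<omega> j = \<rho> j and -1 otherwise. Expanding the product over the subsets B of the
      coordinates writes it as an average of sign tensors.\<close>
    define s :: "nat set \<Rightarrow> nat \<Rightarrow> nat \<Rightarrow> real"
      where "s B j i = (if j \<in> B \<and> i \<noteq> \<rho> j then -1 else 1)" for B j i
    define S where "S B = tensor_of N d (\<lambda>\<omega>. \<Prod>j\<in>{1..d}. s B j (\<omega> j))" for B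
    have "tensor_of N d (\<lambda>\<omega>. if \<omega> = \<rho> then 1 else 0) = (\<Sum>B\<in>Pow {1..d}. (1 / 2 ^ d) *\<^sub>R S B)"
    proof (rule poly_mapping_eqI)
      fix \<omega>
      show "entry (tensor_of N d (\<lambda>\<omega>. if \<omega> = \<rho> then 1 else 0)) \<omega> =
          entry (\<Sum>B\<in>Pow {1..d}. (1 / 2 ^ d) *\<^sub>R S B) \<omega>"
      proof (cases "\<omega> \<in> indices N d")
        case True
        define u :: "nat \<Rightarrow> real" where "u j = (if \<omega> j \<noteq> \<rho> j then -1 else 1)" for j
        have "entry (\<Sum>B\<in>Pow {1..d}. (1 / 2 ^ d) *\<^sub>R S B) \<omega> =
            (\<Sum>B\<in>Pow {1..d}. \<Prod>j\<in>{1..d}. s B j (\<omega> j)) / 2 ^ d"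
          using True by (simp add: lookup_sum S_def entry_tensor_of sum_divide_distrib)
        also have "(\<Sum>B\<in>Pow {1..d}. \<Prod>j\<in>{1..d}. s B j (\<omega> j)) =
            (\<Sum>B\<in>Pow {1..d}. (\<Prod>j\<in>B. u j) * (\<Prod>j\<in>{1..d} - B. 1))"
        proof (intro sum.cong refl)
          fix B assume "B \<in> Pow {1..d}"
          then have B: "B \<subseteq> {1..d}" by simp
          have "(\<Prod>j\<in>{1..d}. s B j (\<omega> j)) = (\<Prod>j\<in>{1..d} - B. s B j (\<omega> j)) * (\<Prod>j\<in>B. s B j (\<omega> j))"
            by (rule prod.subset_diff[OF B]) simp
          also have "\<dots> = (\<Prod>j\<in>{1..d} - B. 1) * (\<Prod>j\<in>B. u j)"
            by (intro arg_cong2[of _ _ _ _ "(*)"] prod.cong) (auto simp: s_def u_def)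
          finally show "(\<Prod>j\<in>{1..d}. s B j (\<omega> j)) = (\<Prod>j\<in>B. u j) * (\<Prod>j\<in>{1..d} - B. 1)"
            by (simp only: mult.commute)
        qed
        also have "\<dots> = (\<Prod>j\<in>{1..d}. u j + 1)"
          by (rule prod_add[symmetric]) simp
        also have "\<dots> = (if \<omega> = \<rho> then 2 ^ d else 0)"
        proof (cases "\<omega> = \<rho>")
          case False
          with True \<rho> obtain j where "j \<in> {1..d}" "\<omega> j \<noteq> \<rho> j"
            unfolding indices_def by (metis PiE_ext)
          then have "\<exists>j\<in>{1..d}. u j + 1 = 0" by (intro bexI[of _ j]) (auto simp: u_def)
          with False show ?thesis by (simp add: prod_zero)
        qed (simp add: u_def)
        finally show ?thesis using True by (simp add: entry_tensor_of)
      next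
        case False
        then show ?thesis by (simp add: lookup_sum S_def entry_tensor_of)
      qed
    qed
    moreover have "S B \<in> G" for B
      unfolding S_def by (intro sign tensor_of_sign_rank_one N) (auto simp: s_def)
    ultimately show ?thesis
      using sub by (auto intro!: subspace_sum subspace_scale)
  qed
  have "T = (\<Sum>\<rho>\<in>indices N d. entry T \<rho> *\<^sub>R tensor_of N d (\<lambda>\<omega>. if \<omega> = \<rho> then 1 else 0))"
  proof (rule poly_mapping_eqI)
    fix \<omega>
    show "entry T \<omega> =
        entry (\<Sum>\<rho>\<in>indices N d. entry T \<rho> *\<^sub>R tensor_of N d (\<lambda>\<omega>. if \<omega> = \<rho> then 1 else 0)) \<omega>"
      using T by (cases "\<omega> \<in> indices N d")
        (auto simp: lookup_sum entry_tensor_of entry_outside finite_indices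
          if_distrib[of "\<lambda>x. _ * x"] cong: if_cong)
  qed
  also have "\<dots> \<in> G"
    using sub single by (auto intro!: subspace_sum subspace_scale)
  finally show ?thesis by (simp add: G_def)
qed

lemma bdd_below_M_norm_set:
  "bdd_below {t. 0 < t \<and> T \<in> (\<lambda>X. t *\<^sub>R X) ` (convex hull sign_rank_one N d)}"
  by (rule bdd_belowI[of _ 0]) auto

lemma M_norm_nonneg:
  assumes "T \<in> tensors N d" "1 \<le> N" "1 \<le> d"
  shows "0 \<le> M_norm N d T"
  unfolding M_norm_def using M_norm_set_nonempty[OF assms] by (intro cInf_greatest) auto

lemma M_norm_lessD:
  assumes "T \<in> tensors N d" "1 \<le> N" "1 \<le> d" "M_norm N d T < t"
  shows "\<exists>s X. 0 < s \<and> s < t \<and> X \<in> convex hull sign_rank_one N d \<and> T = s *\<^sub>R X"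
proof -
  have "\<exists>s\<in>{t. 0 < t \<and> T \<in> (\<lambda>X. t *\<^sub>R X) ` (convex hull sign_rank_one N d)}. s < t"
    using assms(4) M_norm_set_nonempty[OF assms(1-3)] bdd_below_M_norm_set
    unfolding M_norm_def by (subst (asm) cInf_less_iff) auto
  then show ?thesis by auto
qed

text \<open>A linear functional on the hull is at most its maximum B over the sign tensors. As the
  M-norm may not be attained, this first gives the bound t B for each t > R, where B >= 0 (by
  symmetry of the sign tensors) allows enlarging s to t; then t tends to R.\<close>

lemma linear_le_M_norm_mult_Max:
  fixes e :: "'i \<Rightarrow> real" and \<omega> :: "'i \<Rightarrow> tensor_index"
  assumes T: "T \<in> tensors N d" "M_norm N d T \<le> R" and N: "1 \<le> N" and d: "1 \<le> d"
  shows "(\<Sum>i\<in>I. e i * entry T (\<omega> i)) \<le>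
    R * (MAX S\<in>sign_rank_one N d. \<Sum>i\<in>I. e i * entry S (\<omega> i))"
proof -
  define \<phi> where "\<phi> X = (\<Sum>i\<in>I. e i * entry X (\<omega> i))" for X
  define B where "B = (MAX S\<in>sign_rank_one N d. \<phi> S)"
  have \<phi>_scale: "\<phi> (c *\<^sub>R X) = c * \<phi> X" for c X
    by (simp add: \<phi>_def sum_distrib_left mult.left_commute)
  have \<phi>_add: "\<phi> (X + Y) = \<phi> X + \<phi> Y" for X Y
    by (simp add: \<phi>_def lookup_add distrib_left sum.distrib)
  have le_B: "\<phi> S \<le> B" if "S \<in> sign_rank_one N d" for S
    unfolding B_def using that finite_sign_rank_one by auto
  obtain S where S: "S \<in> sign_rank_one N d" using sign_rank_one_nonempty[OF N] by blast
  have "\<phi> (- S) = - \<phi> S" using \<phi>_scale[of "-1" S] by simp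
  then have B: "0 \<le> B"
    using le_B[OF S] le_B[OF sign_rank_one_uminus[OF S d]] by simp
  have "convex {X. \<phi> X \<le> B}"
    by (rule convexI) (simp add: \<phi>_add \<phi>_scale convex_bound_le)
  then have hull: "convex hull sign_rank_one N d \<subseteq> {X. \<phi> X \<le> B}"
    using le_B by (intro hull_minimal) auto
  have le_t: "\<phi> T \<le> t * B" if t: "R < t" for t
  proof -
    from M_norm_lessD[OF T(1) N d, of t] t T(2) obtain s X
      where X: "0 < s" "s < t" "X \<in> convex hull sign_rank_one N d" "T = s *\<^sub>R X" by auto
    have "\<phi> T = s * \<phi> X" by (simp add: X \<phi>_scale)
    also have "\<dots> \<le> s * B" using X hull by (intro mult_left_mono) auto
    also have "\<dots> \<le> t * B" using X B by (intro mult_right_mono) auto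
    finally show ?thesis .
  qed
  have "\<phi> T \<le> R * B"
  proof (cases "B = 0")
    case True
    then show ?thesis using le_t[of "R + 1"] by simp
  next
    case False
    then have "0 < B" using B by simp
    have "\<phi> T / B \<le> R"
    proof (rule dense_ge)
      fix t assume "R < t"
      then show "\<phi> T / B \<le> t" using le_t[of t] \<open>0 < B\<close> by (simp add: pos_divide_le_eq)
    qed
    then show ?thesis using \<open>0 < B\<close> by (simp add: pos_divide_le_eq)
  qed
  then show ?thesis by (simp add: \<phi>_def B_def)
qed

text \<open>Tests the inequality on the tensor of side 1 with entry 1. Its M-norm is at least 1,
  since entries of the hull are at most 1, and a single column of ones shows that its max-qnorm is
  at most 1. The factor does not involve N, so side 1 suffices.\<close>

lemma grothendieck_constants_ge_one:
  assumes G: "grothendieck_constants c\<^sub>1 c\<^sub>2" and d: "2 \<le> d"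
  shows "1 \<le> c\<^sub>1 * c\<^sub>2 ^ d"
proof -
  define J where "J = tensor_of 1 d (\<lambda>_. 1)"
  have J: "J \<in> tensors 1 d" by (simp add: J_def tensor_of_in_tensors)
  obtain \<omega> where \<omega>: "\<omega> \<in> indices 1 d" using indices_nonempty[of 1 d] by auto
  have M: "1 \<le> M_norm 1 d J"
    unfolding M_norm_def
  proof (rule cInf_greatest)
    show "{t. 0 < t \<and> J \<in> (\<lambda>X. t *\<^sub>R X) ` (convex hull sign_rank_one 1 d)} \<noteq> {}"
      using M_norm_set_nonempty[OF J] d by auto
    have "convex {X. entry X \<omega> \<le> 1}"
      by (rule convexI) (simp add: lookup_add convex_bound_le)
    moreover have "sign_rank_one 1 d \<subseteq> {X. entry X \<omega> \<le> 1}"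
      using sign_rank_one_abs_entry[OF _ \<omega>] by (auto simp: abs_le_iff intro: order_trans[OF abs_ge_self])
    ultimately have hull: "convex hull sign_rank_one 1 d \<subseteq> {X. entry X \<omega> \<le> 1}"
      by (intro hull_minimal)
    fix t assume "t \<in> {t. 0 < t \<and> J \<in> (\<lambda>X. t *\<^sub>R X) ` (convex hull sign_rank_one 1 d)}"
    then obtain X where X: "0 < t" "X \<in> convex hull sign_rank_one 1 d" "J = t *\<^sub>R X" by auto
    have "1 = entry J \<omega>" using \<omega> by (simp add: J_def entry_tensor_of)
    also have "\<dots> = t * entry X \<omega>" by (simp add: X(3))
    also have "\<dots> \<le> t * 1" using X hull by (intro mult_left_mono) auto
    finally show "1 \<le> t" by simp
  qed
  define Q where "Q = {\<Prod>j\<in>{1..d}. row_norm 1 k (U j) | k U. factorizes 1 d k U J}"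
  have row_nonneg: "0 \<le> row_norm 1 k V" for k V
    by (simp add: row_norm_def L2_set_nonneg)
  have "row_norm 1 1 (\<lambda>_ _. 1) = 1" by (simp add: row_norm_def)
  moreover have "factorizes 1 d 1 (\<lambda>_ _ _. 1) J" by (simp add: factorizes_def J_def entry_tensor_of)
  ultimately have "1 \<in> Q"
    unfolding Q_def by (auto intro!: exI[of _ 1] exI[of _ "\<lambda>_ _ _. 1"])
  moreover have Q0: "0 \<le> q" if "q \<in> Q" for q
    using that row_nonneg unfolding Q_def by (auto intro!: prod_nonneg simp del: One_nat_def)
  ultimately have q: "0 \<le> Inf Q" "Inf Q \<le> 1"
    by (auto intro!: cInf_greatest cInf_lower bdd_belowI[of _ 0])
  have "1 \<le> c\<^sub>1 * c\<^sub>2 ^ d * Inf Q"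
    using G d J M unfolding grothendieck_constants_def max_qnorm_def Q_def
    by (meson order.trans order_refl)
  with q show ?thesis
    by (smt (verit) mult_left_le mult_nonneg_nonneg mult_nonpos_nonneg)
qed

section \<open>The likelihood estimator\<close>

text \<open>Joining each index with its bit turns the two-stage model into m independent,
  identically distributed draws, the form required by the concentration results.\<close>

definition sample_pmf :: "tensor_index pmf \<Rightarrow> (real \<Rightarrow> real) \<Rightarrow> tensor \<Rightarrow> (tensor_index \<times> int) pmf" where
  "sample_pmf \<pi> f T = bind_pmf \<pi> (\<lambda>w. map_pmf (Pair w) (bit_pmf (f (entry T w))))"

text \<open>Products commute with \<open>bind_pmf\<close>, so drawing all indices and then all bits
  is the same as drawing pairs. The default (undefined, 0) splits into the defaults of the two
  stages.\<close>

lemma observation_pmf_conv_Pi_pmf: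
  "observation_pmf m \<pi> f T =
    map_pmf (\<lambda>z. (fst \<circ> z, snd \<circ> z)) (Pi_pmf {1..m} (undefined, 0) (\<lambda>_. sample_pmf \<pi> f T))"
proof -
  let ?I = "{1..m}"
  let ?B = "\<lambda>\<omega> i. bit_pmf (f (entry T (\<omega> i)))"
  \<comment> \<open>The two sides agree as functions only if \<omega> takes the default value
    outside the samples, which holds on the support of the first stage.\<close>
  have inner: "map_pmf (\<lambda>z. (fst \<circ> z, snd \<circ> z))
      (Pi_pmf ?I (undefined, 0) (\<lambda>i. map_pmf (Pair (\<omega> i)) (?B \<omega> i))) =
      map_pmf (Pair \<omega>) (Pi_pmf ?I 0 (?B \<omega>))"
    if \<omega>: "\<And>i. i \<notin> ?I \<Longrightarrow> \<omega> i = undefined" for \<omega>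
  proof -
    have "Pi_pmf ?I (undefined, 0) (\<lambda>i. map_pmf (Pair (\<omega> i)) (?B \<omega> i)) =
        bind_pmf (Pi_pmf ?I 0 (?B \<omega>))
          (\<lambda>Y. return_pmf (\<lambda>i. if i \<in> ?I then (\<omega> i, Y i) else (undefined, 0)))"
      by (simp add: map_pmf_def Pi_pmf_bind[where d' = 0])
    then have "map_pmf (\<lambda>z. (fst \<circ> z, snd \<circ> z))
        (Pi_pmf ?I (undefined, 0) (\<lambda>i. map_pmf (Pair (\<omega> i)) (?B \<omega> i))) =
        bind_pmf (Pi_pmf ?I 0 (?B \<omega>)) (\<lambda>Y. return_pmf
          (\<lambda>i. fst (if i \<in> ?I then (\<omega> i, Y i) else (undefined, 0)),
           \<lambda>i. snd (if i \<in> ?I then (\<omega> i, Y i) else (undefined, 0))))"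
      by (simp add: map_bind_pmf comp_def)
    also have "\<dots> = bind_pmf (Pi_pmf ?I 0 (?B \<omega>)) (\<lambda>Y. return_pmf (\<omega>, Y))"
    proof (intro bind_pmf_cong refl)
      fix Y assume "Y \<in> set_pmf (Pi_pmf ?I 0 (?B \<omega>))"
      then have "Y i = 0" if "i \<notin> ?I" for i
        using that set_Pi_pmf_subset[of ?I 0 "?B \<omega>"] by auto
      then have "(\<lambda>i. fst (if i \<in> ?I then (\<omega> i, Y i) else (undefined, 0))) = \<omega>"
        "(\<lambda>i. snd (if i \<in> ?I then (\<omega> i, Y i) else (undefined, 0))) = Y"
        using \<omega> by (auto simp: fun_eq_iff)
      then show "return_pmf (\<lambda>i. fst (if i \<in> ?I then (\<omega> i, Y i) else (undefined, 0)),
          \<lambda>i. snd (if i \<in> ?I then (\<omega> i, Y i) else (undefined, 0))) = return_pmf (\<omega>, Y)"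
        by (simp only:)
    qed
    finally show ?thesis by (simp add: map_pmf_def)
  qed
  have "map_pmf (\<lambda>z. (fst \<circ> z, snd \<circ> z)) (Pi_pmf ?I (undefined, 0) (\<lambda>_. sample_pmf \<pi> f T)) =
      bind_pmf (Pi_pmf ?I undefined (\<lambda>_. \<pi>)) (\<lambda>\<omega>. map_pmf (\<lambda>z. (fst \<circ> z, snd \<circ> z))
        (Pi_pmf ?I (undefined, 0) (\<lambda>i. map_pmf (Pair (\<omega> i)) (?B \<omega> i))))"
    by (simp add: sample_pmf_def Pi_pmf_bind[where d' = undefined] map_bind_pmf)
  also have "\<dots> = bind_pmf (Pi_pmf ?I undefined (\<lambda>_. \<pi>)) (\<lambda>\<omega>. map_pmf (Pair \<omega>) (Pi_pmf ?I 0 (?B \<omega>)))"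
  proof (rule bind_pmf_cong[OF refl inner])
    fix \<omega> i assume "\<omega> \<in> set_pmf (Pi_pmf ?I undefined (\<lambda>_. \<pi>))" "i \<notin> ?I"
    then show "\<omega> i = undefined"
      using set_Pi_pmf_subset[of ?I undefined "\<lambda>_. \<pi>"] by auto
  qed
  finally show ?thesis by (simp add: observation_pmf_def map_pmf_def)
qed

lemma set_sample_pmf_subset: "set_pmf (sample_pmf \<pi> f T) \<subseteq> set_pmf \<pi> \<times> {-1, 1}"
  by (auto simp: sample_pmf_def bit_pmf_def)

lemma finite_set_bit_pmf: "finite (set_pmf (bit_pmf p))"
  by (simp add: bit_pmf_def)

lemma expectation_sample_pmf:
  fixes h :: "tensor_index \<times> int \<Rightarrow> real"
  assumes "finite (set_pmf \<pi>)" "\<And>x. 0 \<le> f x \<and> f x \<le> 1"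
  shows "measure_pmf.expectation (sample_pmf \<pi> f T) h = measure_pmf.expectation \<pi>
    (\<lambda>w. f (entry T w) * h (w, 1) + (1 - f (entry T w)) * h (w, -1))"
  using assms
  by (simp add: sample_pmf_def expectation_bind_pmf_finite finite_set_bit_pmf)
     (simp add: bit_pmf_def mult.commute)

definition bit_loss :: "(real \<Rightarrow> real) \<Rightarrow> real \<Rightarrow> int \<Rightarrow> real" where
  "bit_loss f x y = of_bool (y = 1) * ln (1 / f x) + of_bool (y = -1) * ln (1 / (1 - f x))"

lemma neg_log_likelihood_conv_bit_loss:
  "neg_log_likelihood m f (fst \<circ> z, snd \<circ> z) X =
    (\<Sum>i\<in>{1..m}. bit_loss f (entry X (fst (z i))) (snd (z i)))"
  by (simp add: neg_log_likelihood_def bit_loss_def)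

lemma bit_loss_1 [simp]: "0 < f x \<Longrightarrow> bit_loss f x 1 = - ln (f x)"
  by (simp add: bit_loss_def ln_div)

lemma bit_loss_minus_1 [simp]: "f x < 1 \<Longrightarrow> bit_loss f x (-1) = - ln (1 - f x)"
  by (simp add: bit_loss_def ln_div)

text \<open>Values that never occur as bits matter because the bounded differences hypothesis is not
  restricted to the support.\<close>

lemma bit_loss_other: "y \<noteq> 1 \<Longrightarrow> y \<noteq> -1 \<Longrightarrow> bit_loss f x y = 0"
  by (simp add: bit_loss_def)

lemma bit_loss_bounds:
  assumes "admissible_link \<alpha> f" "0 < \<alpha>" "x \<in> {-\<alpha>..\<alpha>}"
  shows "0 \<le> bit_loss f x y" "bit_loss f x y \<le> U_const \<alpha> f"
proof -
  have "0 \<le> bit_loss f x y \<and> bit_loss f x y \<le> U_const \<alpha> f"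
    using neg_ln_link_bounds[OF assms] link_pos[OF assms] link_less_one[OF assms]
      U_const_pos[OF assms(1,2)]
    by (cases "y = 1 \<or> y = -1") (auto simp: bit_loss_other)
  then show "0 \<le> bit_loss f x y" "bit_loss f x y \<le> U_const \<alpha> f" by auto
qed

lemma bit_loss_lipschitz:
  assumes "admissible_link \<alpha> f" "0 < \<alpha>" "x \<in> {-\<alpha>..\<alpha>}" "x' \<in> {-\<alpha>..\<alpha>}"
  shows "bit_loss f x y - bit_loss f x' y \<le> L_const \<alpha> f * \<bar>x - x'\<bar>"
proof -
  note f = link_pos[OF assms(1-3)] link_less_one[OF assms(1-3)]
    link_pos[OF assms(1,2,4)] link_less_one[OF assms(1,2,4)]
  consider "y = 1" | "y = -1" | "y \<noteq> 1" "y \<noteq> -1" by blast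
  then show ?thesis
  proof cases
    case 3
    then show ?thesis using L_const_nonneg[OF assms(1,2)] by (simp add: bit_loss_other)
  qed (use f neg_ln_link_lipschitz[OF assms] in \<open>simp_all add: abs_le_iff\<close>)
qed

section \<open>The empirical process and the general estimate\<close>

lemma Max_diff_le:
  fixes u v :: "'a \<Rightarrow> real"
  assumes "finite K" "K \<noteq> {}" "\<And>x. x \<in> K \<Longrightarrow> u x - v x \<le> c"
  shows "(MAX x\<in>K. u x) - (MAX x\<in>K. v x) \<le> c"
proof -
  obtain x where x: "x \<in> K" "(MAX x\<in>K. u x) = u x"
    using Max_image_attained[OF assms(1,2)] by blast
  have "v x \<le> (MAX x\<in>K. v x)" using x assms(1) by auto
  then show ?thesis using x assms(3)[of x] by simp
qed

lemma sum_fun_upd_diff: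
  fixes w :: "'a \<Rightarrow> real"
  assumes "finite I" "i \<in> I"
  shows "(\<Sum>j\<in>I. w ((z(i := x)) j)) - (\<Sum>j\<in>I. w ((z(i := y)) j)) = w x - w y"
proof -
  have I: "insert i (I - {i}) = I" using assms by auto
  have "(\<Sum>j\<in>I. w ((z(i := u)) j)) = w u + (\<Sum>j\<in>I - {i}. w (z j))" for u
    using sum_insert_fun_upd[of "I - {i}" i w z u] assms unfolding I by simp
  then show ?thesis by simp
qed

lemma expectation_Max_signed_sign_rank_one:
  fixes p :: "(tensor_index \<times> 'b) pmf"
  assumes p: "finite (set_pmf p)" "fst ` set_pmf p \<subseteq> indices N d" and N: "1 \<le> N" and d: "1 \<le> d"
    and m: "1 \<le> m"
  shows "measure_pmf.expectation (Pi_pmf {1..m} dflt (\<lambda>_. pair_pmf p rademacher_pmf))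
      (\<lambda>v. MAX S\<in>sign_rank_one N d. \<Sum>i\<in>{1..m}. snd (v i) * entry S (fst (fst (v i)))) \<le>
    5 / 2 * sqrt (real d * real N * real m)"
proof -
  define r where "r = pair_pmf p rademacher_pmf"
  define \<phi> where "\<phi> S v = snd v * entry S (fst (fst v))" for S and v :: "(tensor_index \<times> 'b) \<times> real"
  define D where "D = real d * real N"
  have D: "0 < D" using N d by (simp add: D_def)
  \<comment> \<open>Makes D / l and l m both equal to sqrt(D m). With ln 3 <= 2 and signed entries
    oscillating by 2, the maximal inequality becomes (2 + 1/2) sqrt(D m).\<close>
  define l where "l = sqrt (D / m)"
  have l: "0 < l" using D m by (simp add: l_def)
  have finr: "finite (set_pmf r)" using p by (simp add: r_def set_rademacher_pmf)
  have abs1: "\<bar>\<phi> S v\<bar> = 1" if "S \<in> sign_rank_one N d" "v \<in> set_pmf r" for S v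
  proof -
    have "fst (fst v) \<in> indices N d" "\<bar>snd v\<bar> = 1"
      using that p by (auto simp: r_def set_rademacher_pmf)
    then show ?thesis using sign_rank_one_abs_entry[OF that(1)] by (simp add: \<phi>_def abs_mult)
  qed
  let ?C = "\<phi> ` sign_rank_one N d"
  have finC: "finite ?C" and neC: "?C \<noteq> {}"
    using finite_sign_rank_one sign_rank_one_nonempty[OF N] by auto
  have "measure_pmf.expectation (Pi_pmf {1..m} dflt (\<lambda>_. r)) (\<lambda>v. MAX s\<in>?C. \<Sum>i\<in>{1..m}. s (v i)) \<le>
      ln (card ?C) / l + l * 2\<^sup>2 * card {1..m} / 8"
  proof (rule expectation_Max_finite_class[OF finr finC neC _ l])
    fix s assume "s \<in> ?C"
    then obtain S where S: "S \<in> sign_rank_one N d" "s = \<phi> S" by blast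
    show "measure_pmf.expectation r s = 0"
      using p by (simp add: S(2) r_def expectation_pair_pmf_finite set_rademacher_pmf
          expectation_rademacher_pmf \<phi>_def)
    fix x y assume "x \<in> set_pmf r" "y \<in> set_pmf r"
    then show "s x - s y \<le> 2" using abs1[OF S(1), of x] abs1[OF S(1), of y] S(2) by auto
  qed simp
  also have "ln (card ?C) \<le> 2 * D"
  proof -
    have "card ?C \<le> card (sign_rank_one N d)" by (rule card_image_le[OF finite_sign_rank_one])
    also have "\<dots> \<le> 3 ^ (d * N)" by (rule card_sign_rank_one)
    finally have "real (card ?C) \<le> 3 ^ (d * N)"
      by (metis of_nat_le_iff of_nat_numeral of_nat_power)
    moreover have "0 < card ?C" using finC neC by (simp add: card_gt_0_iff)
    ultimately have "ln (card ?C) \<le> ln (3 ^ (d * N))" by (subst ln_le_cancel_iff) auto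
    also have "\<dots> = D * ln 3" by (simp add: ln_realpow D_def)
    also have "\<dots> \<le> D * 2" using D ln_le_minus_one[of 3] by (intro mult_left_mono) auto
    finally show ?thesis by simp
  qed
  finally have "measure_pmf.expectation (Pi_pmf {1..m} dflt (\<lambda>_. r))
      (\<lambda>v. MAX s\<in>?C. \<Sum>i\<in>{1..m}. s (v i)) \<le> 2 * D / l + l * m / 2"
    using l by (simp add: divide_right_mono)
  also have "D / l = sqrt (D * m)"
  proof -
    have "D = sqrt (D * m) * l"
      using D m by (simp add: l_def flip: real_sqrt_mult)
    then show ?thesis using l by (metis nonzero_mult_div_cancel_right less_irrefl)
  qed
  then have "2 * D / l = 2 * sqrt (D * m)" by simp
  also have "l * m = sqrt (D * m)"
    using D m by (simp add: l_def real_sqrt_divide real_sqrt_mult field_simps)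
  also have "2 * sqrt (D * m) + sqrt (D * m) / 2 = 5 / 2 * sqrt (D * m)" by simp
  finally show ?thesis by (simp add: r_def \<phi>_def D_def image_image)
qed

text \<open>K is only sandwiched between {T} and \<open>K_M\<close>, so the max-qnorm set can be
  used with an enlarged radius while the minimizer still ranges over the original set. The constant
  40 is 8, from the divergence, times 5, from symmetrization (2) and the maximal inequality
  (5/2).\<close>

lemma likelihood_estimation_bound:
  assumes link: "admissible_link \<alpha> f" and \<alpha>: "0 < \<alpha>"
    and N: "1 \<le> N" and d: "1 \<le> d" and m: "1 \<le> m" and \<delta>: "0 < \<delta>" "\<delta> < 1"
    and \<pi>: "set_pmf \<pi> \<subseteq> indices N d" and T: "T \<in> K" and K: "K \<subseteq> K_M N d \<alpha> R"
  shows "measure_pmf.prob (observation_pmf m \<pi> f T)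
    {obs. \<forall>T'. is_arg_min (neg_log_likelihood m f obs) (\<lambda>X. X \<in> K) T' \<longrightarrow>
       sq_dist N d \<pi> T' T \<le> 40 * \<beta>_const \<alpha> f *
         (L_const \<alpha> f * R * sqrt (real d * real N / real m) +
          U_const \<alpha> f * sqrt (ln (4 / \<delta>) / real m))} \<ge> 1 - \<delta>"
proof -
  define q where "q = sample_pmf \<pi> f T"
  define P where "P = Pi_pmf {1..m} (undefined, 0 :: int) (\<lambda>_. q)"
  \<comment> \<open>Subtracting the loss at \<open>T\<close> makes the empirical sum of a minimizer
    nonpositive and the expectation a divergence.\<close>
  define g where "g X z = bit_loss f (entry X (fst z)) (snd z) - bit_loss f (entry T (fst z)) (snd z)"
    for X and z :: "tensor_index \<times> int"
  define L U \<beta> where "L = L_const \<alpha> f" and "U = U_const \<alpha> f" and "\<beta> = \<beta>_const \<alpha> f"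
  note L = L_const_nonneg[OF link \<alpha>, folded L_def] and U = U_const_pos[OF link \<alpha>, folded U_def]
    and \<beta> = beta_const_pos[OF link \<alpha>, folded \<beta>_def]
  define bnd where "bnd = L * R * sqrt (real d * real N / real m) + U * sqrt (ln (4 / \<delta>) / real m)"
  \<comment> \<open>Every minimizer violating the bound is bad, but badness asks only for a
    comparison with \<open>T\<close>.\<close>
  define bad where "bad z X \<longleftrightarrow> X \<in> K \<and> (\<Sum>i\<in>{1..m}. g X (z i)) \<le> 0 \<and>
      40 * \<beta> * bnd < sq_dist N d \<pi> X T" for z X
  have fin\<pi>: "finite (set_pmf \<pi>)" using \<pi> finite_indices by (rule finite_subset)
  have finq: "finite (set_pmf q)"
    unfolding q_def using set_sample_pmf_subset by (rule finite_subset) (simp add: fin\<pi>)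
  have fst_q: "fst ` set_pmf q \<subseteq> indices N d"
    using set_sample_pmf_subset[of \<pi> f T] \<pi> by (auto simp: q_def)
  have finP: "finite (set_pmf P)" unfolding P_def by (intro finite_set_Pi_pmf finq) simp
  have tensor: "X \<in> tensors N d" "M_norm N d X \<le> R" if "X \<in> K" for X
    using that K by (auto simp: K_M_def)
  have R: "0 \<le> R" using M_norm_nonneg[OF tensor(1)[OF T] N d] tensor(2)[OF T] by simp
  have range: "entry X w \<in> {-\<alpha>..\<alpha>}" if "X \<in> K" for X w
    using abs_entry_le[of X N d \<alpha> w] that K \<alpha> by (auto simp: K_M_def abs_le_iff)
  have f01: "0 \<le> f x \<and> f x \<le> 1" for x using link by (auto simp: admissible_link_def)

  text \<open>
    The data take only finitely many values, so one violating competitor per data value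
    suffices and the suprema over $K$ become maxima over a finite set.
  \<close>
  define X\<^sub>0 where "X\<^sub>0 z = (SOME X. bad z X)" for z
  \<comment> \<open>\<open>T\<close> is added so that the maximum is over a nonempty set even when
    no data value is bad.\<close>
  define K\<^sub>0 where "K\<^sub>0 = insert T (X\<^sub>0 ` {z \<in> set_pmf P. \<exists>X. bad z X})"
  have bad_X\<^sub>0: "bad z (X\<^sub>0 z)" if "\<exists>X. bad z X" for z
    unfolding X\<^sub>0_def using that by (rule someI_ex)
  have K\<^sub>0: "finite K\<^sub>0" "K\<^sub>0 \<noteq> {}" "K\<^sub>0 \<subseteq> K"
    using finP T bad_X\<^sub>0 by (auto simp: K\<^sub>0_def bad_def)
  define F where "F z = (MAX X\<in>K\<^sub>0. 0 + (\<Sum>i\<in>{1..m}. measure_pmf.expectation q (g X) - g X (z i)))"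
    for z

  have diff: "F (z(i := x)) - F (z(i := y)) \<le> 2 * U" if i: "i \<in> {1..m}" for i z x y
    unfolding F_def
  proof (rule Max_diff_le[OF K\<^sub>0(1,2)])
    fix X assume "X \<in> K\<^sub>0"
    then have X: "X \<in> K" using K\<^sub>0(3) by auto
    have "\<bar>g X z\<bar> \<le> U" for z
      using bit_loss_bounds[OF link \<alpha> range[OF X, of "fst z"], of "snd z"]
        bit_loss_bounds[OF link \<alpha> range[OF T, of "fst z"], of "snd z"]
      by (simp add: g_def U_def abs_le_iff)
    then have "g X y \<le> U" "- g X x \<le> U" by (auto simp: abs_le_iff)
    then show "0 + (\<Sum>j\<in>{1..m}. measure_pmf.expectation q (g X) - g X ((z(i := x)) j)) -
        (0 + (\<Sum>j\<in>{1..m}. measure_pmf.expectation q (g X) - g X ((z(i := y)) j))) \<le> 2 * U"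
      using sum_fun_upd_diff[OF finite_atLeastAtMost i,
          of "\<lambda>v. measure_pmf.expectation q (g X) - g X v" z x y]
      by simp
  qed
  \<comment> \<open>Solves \<open>exp (- 2 * s\<^sup>2 / (m * (2 * U)\<^sup>2)) = \<delta>\<close>,
    with 2 U the bound on the differences of F.\<close>
  define s where "s = U * sqrt (2 * m * ln (1 / \<delta>))"
  have s: "0 < s" using U m \<delta> by (simp add: s_def)
  have tail: "measure_pmf.prob P {z. measure_pmf.expectation P F + s \<le> F z} \<le> \<delta>"
  proof -
    have "measure_pmf.prob P {z. measure_pmf.expectation P F + s \<le> F z} \<le>
        exp (- 2 * s\<^sup>2 / (card {1..m} * (2 * U)\<^sup>2))"
      unfolding P_def using m U s finq diff by (intro bounded_differences_tail) auto
    also have "- 2 * s\<^sup>2 / (card {1..m} * (2 * U)\<^sup>2) = ln \<delta>"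
    proof -
      have "s\<^sup>2 = U\<^sup>2 * (2 * m * ln (1 / \<delta>))"
        using \<delta> by (simp add: s_def power_mult_distrib)
      also have "ln (1 / \<delta>) = - ln \<delta>" using \<delta> by (simp add: ln_div)
      finally show ?thesis using U m by (simp add: power_mult_distrib)
    qed
    finally show ?thesis using \<delta> by simp
  qed

  have mean: "measure_pmf.expectation P F \<le> 5 * L * R * sqrt (real d * real N * real m)"
  proof -
    let ?Q = "Pi_pmf {1..m} undefined (\<lambda>_. pair_pmf q rademacher_pmf)"
    have finQ: "finite (set_pmf ?Q)"
      using finq by (intro finite_set_Pi_pmf) (auto simp: set_rademacher_pmf)
    have "measure_pmf.expectation P F \<le> measure_pmf.expectation ?Q
        (\<lambda>v. MAX X\<in>K\<^sub>0. 0 + (\<Sum>i\<in>{1..m}. 2 * snd (v i) * (L * entry X (fst (fst (v i))))))"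
      unfolding P_def F_def
    proof (rule symmetrization_contraction[OF finq K\<^sub>0(1,2)])
      fix X X' z assume "X \<in> K\<^sub>0" "X' \<in> K\<^sub>0"
      then have "X \<in> K" "X' \<in> K" using K\<^sub>0(3) by auto
      then show "g X z - g X' z \<le> \<bar>L * entry X (fst z) - L * entry X' (fst z)\<bar>"
        using bit_loss_lipschitz[OF link \<alpha> range range] L
        by (simp add: g_def L_def abs_mult flip: right_diff_distrib)
    qed simp
    also have "\<dots> \<le> measure_pmf.expectation ?Q (\<lambda>v. 2 * L * R *
        (MAX S\<in>sign_rank_one N d. \<Sum>i\<in>{1..m}. snd (v i) * entry S (fst (fst (v i)))))"
    proof (rule expectation_mono_pmf[OF finQ], rule Max.boundedI)
      fix v b
      assume "b \<in> (\<lambda>X. 0 + (\<Sum>i\<in>{1..m}. 2 * snd (v i) * (L * entry X (fst (fst (v i)))))) ` K\<^sub>0"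
      then obtain X where X: "X \<in> K\<^sub>0"
        and b: "b = (\<Sum>i\<in>{1..m}. 2 * snd (v i) * (L * entry X (fst (fst (v i)))))" by auto
      have "b = 2 * L * (\<Sum>i\<in>{1..m}. snd (v i) * entry X (fst (fst (v i))))"
        unfolding b sum_distrib_left by (intro sum.cong) auto
      also have "\<dots> \<le> 2 * L * (R *
          (MAX S\<in>sign_rank_one N d. \<Sum>i\<in>{1..m}. snd (v i) * entry S (fst (fst (v i)))))"
        using X K\<^sub>0(3) L by (intro mult_left_mono linear_le_M_norm_mult_Max tensor N d) auto
      finally show "b \<le> 2 * L * R *
          (MAX S\<in>sign_rank_one N d. \<Sum>i\<in>{1..m}. snd (v i) * entry S (fst (fst (v i))))"
        by (simp only: mult.assoc)
    qed (use K\<^sub>0 in auto)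
    also have "\<dots> = 2 * L * R * measure_pmf.expectation ?Q
        (\<lambda>v. MAX S\<in>sign_rank_one N d. \<Sum>i\<in>{1..m}. snd (v i) * entry S (fst (fst (v i))))"
      by (rule integral_mult_right_zero)
    also have "\<dots> \<le> 2 * L * R * (5 / 2 * sqrt (real d * real N * real m))"
      using L R by (intro mult_left_mono expectation_Max_signed_sign_rank_one finq fst_q N d m) auto
    finally show ?thesis by simp
  qed

  have excess: "sq_dist N d \<pi> X T \<le> 8 * \<beta> * measure_pmf.expectation q (g X)" if X: "X \<in> K" for X
  proof -
    have "sq_dist N d \<pi> X T = measure_pmf.expectation \<pi> (\<lambda>w. (entry T w - entry X w)\<^sup>2)"
      using \<pi> by (subst integral_measure_pmf[OF finite_indices])
        (auto simp: sq_dist_def power2_commute)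
    also have "\<dots> \<le> measure_pmf.expectation \<pi> (\<lambda>w. 8 * \<beta> *
        (f (entry T w) * g X (w, 1) + (1 - f (entry T w)) * g X (w, -1)))"
    proof (rule expectation_mono_pmf[OF fin\<pi>])
      fix w
      note f = link_pos[OF link \<alpha> range[OF X, of w]] link_less_one[OF link \<alpha> range[OF X, of w]]
        link_pos[OF link \<alpha> range[OF T, of w]] link_less_one[OF link \<alpha> range[OF T, of w]]
      show "(entry T w - entry X w)\<^sup>2 \<le> 8 * \<beta> *
          (f (entry T w) * g X (w, 1) + (1 - f (entry T w)) * g X (w, -1))"
        using link_KL_ge[OF link \<alpha> range[OF T, of w] range[OF X, of w]] f
        by (simp add: g_def \<beta>_def)
    qed
    also have "\<dots> = 8 * \<beta> * measure_pmf.expectation q (g X)"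
      unfolding q_def expectation_sample_pmf[OF fin\<pi> f01] by (rule integral_mult_right_zero)
    finally show ?thesis .
  qed

  \<comment> \<open>A bad competitor has expected excess risk at least 5 \<open>bnd\<close> and
    nonpositive empirical excess risk, so F z is at least 5 m \<open>bnd\<close>. Its L part equals
    the bound on the mean of F, and its U part dominates s.\<close>
  have bad: "measure_pmf.expectation P F + s \<le> F z" if z: "z \<in> set_pmf P" "\<exists>X. bad z X" for z
  proof -
    define X where "X = X\<^sub>0 z"
    have X: "X \<in> K\<^sub>0" "X \<in> K" "(\<Sum>i\<in>{1..m}. g X (z i)) \<le> 0" "40 * \<beta> * bnd < sq_dist N d \<pi> X T"
      using z bad_X\<^sub>0[OF z(2)] by (auto simp: X_def K\<^sub>0_def bad_def)
    have "8 * \<beta> * (5 * bnd) \<le> 8 * \<beta> * measure_pmf.expectation q (g X)"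
      using X(4) excess[OF X(2)] by simp
    then have "5 * bnd \<le> measure_pmf.expectation q (g X)"
      using \<beta> by simp
    then have "m * (5 * bnd) \<le> m * measure_pmf.expectation q (g X)"
      by (rule mult_left_mono) simp
    also have "\<dots> \<le> (\<Sum>i\<in>{1..m}. measure_pmf.expectation q (g X) - g X (z i))"
      using X(3) by (simp add: sum_subtractf)
    also have "\<dots> \<le> F z"
      unfolding F_def using X(1) K\<^sub>0(1) by (intro Max_ge) auto
    finally have F: "5 * (m * bnd) \<le> F z" by simp
    have sqrt_m: "m * sqrt (a / m) = sqrt (a * m)" if "0 \<le> a" for a :: real
      using m that by (simp add: real_sqrt_divide real_sqrt_mult field_simps)
    have "s \<le> U * (5 * sqrt (ln (4 / \<delta>) * m))"
      unfolding s_def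
    proof (rule mult_left_mono)
      have "0 \<le> ln (1 / \<delta>)" "ln (1 / \<delta>) \<le> ln (4 / \<delta>)"
        using \<delta> by (auto simp: divide_right_mono)
      then have "2 * (m * ln (1 / \<delta>)) \<le> 25 * (m * ln (4 / \<delta>))"
        by (intro mult_mono) auto
      then have "sqrt (2 * m * ln (1 / \<delta>)) \<le> sqrt (25 * (ln (4 / \<delta>) * m))"
        by (simp add: mult_ac)
      also have "\<dots> = sqrt (5\<^sup>2) * sqrt (ln (4 / \<delta>) * m)"
        by (subst real_sqrt_mult) simp
      finally show "sqrt (2 * m * ln (1 / \<delta>)) \<le> 5 * sqrt (ln (4 / \<delta>) * m)"
        by (simp only: real_sqrt_abs abs_numeral)
    qed (use U in simp)
    moreover have "m * bnd = L * R * sqrt (real d * real N * m) + U * sqrt (ln (4 / \<delta>) * m)"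
    proof -
      have "m * bnd = L * R * (m * sqrt (real d * real N / m)) + U * (m * sqrt (ln (4 / \<delta>) / m))"
        by (simp add: bnd_def algebra_simps)
      also have "m * sqrt (real d * real N / m) = sqrt (real d * real N * m)"
        by (rule sqrt_m) simp
      also have "m * sqrt (ln (4 / \<delta>) / m) = sqrt (ln (4 / \<delta>) * m)"
        using \<delta> by (intro sqrt_m) simp
      finally show ?thesis .
    qed
    ultimately show ?thesis using F mean by (simp add: algebra_simps)
  qed

  let ?good = "{obs. \<forall>T'. is_arg_min (neg_log_likelihood m f obs) (\<lambda>X. X \<in> K) T' \<longrightarrow>
       sq_dist N d \<pi> T' T \<le> 40 * \<beta> * bnd}"
  have good: "(fst \<circ> z, snd \<circ> z) \<in> ?good" if z: "z \<in> set_pmf P" "\<not> (\<exists>X. bad z X)" for z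
  proof (rule CollectI, intro allI impI)
    fix T' assume "is_arg_min (neg_log_likelihood m f (fst \<circ> z, snd \<circ> z)) (\<lambda>X. X \<in> K) T'"
    then have "T' \<in> K"
      "neg_log_likelihood m f (fst \<circ> z, snd \<circ> z) T' \<le> neg_log_likelihood m f (fst \<circ> z, snd \<circ> z) T"
      using T unfolding is_arg_min_def by (auto simp: not_less)
    then have "T' \<in> K" "(\<Sum>i\<in>{1..m}. g T' (z i)) \<le> 0"
      by (auto simp: neg_log_likelihood_conv_bit_loss g_def sum_subtractf)
    with z(2) show "sq_dist N d \<pi> T' T \<le> 40 * \<beta> * bnd" by (auto simp: bad_def not_less)
  qed
  have "1 - \<delta> \<le> 1 - measure_pmf.prob P {z. measure_pmf.expectation P F + s \<le> F z}"
    using tail by simp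
  also have "\<dots> = measure_pmf.prob P (- {z. measure_pmf.expectation P F + s \<le> F z})"
    using measure_pmf.prob_compl[of "{z. measure_pmf.expectation P F + s \<le> F z}" P]
    by (simp add: Compl_eq_Diff_UNIV)
  also have "\<dots> \<le> measure_pmf.prob P ((\<lambda>z. (fst \<circ> z, snd \<circ> z)) -` ?good)"
  proof (intro measure_pmf.finite_measure_mono_AE AE_pmfI)
    fix z assume "z \<in> set_pmf P"
    then show "z \<in> - {z. measure_pmf.expectation P F + s \<le> F z} \<longrightarrow>
        z \<in> (\<lambda>z. (fst \<circ> z, snd \<circ> z)) -` ?good"
      using bad[of z] good[of z] by blast
  qed simp
  also have "\<dots> = measure_pmf.prob (observation_pmf m \<pi> f T) ?good"
    by (simp add: observation_pmf_conv_Pi_pmf P_def q_def)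
  finally show ?thesis by (simp add: \<beta>_def bnd_def L_def U_def)
qed

theorem theorem3:
  fixes c\<^sub>1 c\<^sub>2 :: real
  assumes "grothendieck_constants c\<^sub>1 c\<^sub>2"
  shows "\<exists>Cmax CM :: real.
    \<forall>(d :: nat) (N :: nat) (m :: nat) (\<alpha> :: real) (f :: real \<Rightarrow> real)
       (\<pi> :: tensor_index pmf) (T :: tensor) (\<delta> :: real).
      2 \<le> d \<and> 1 \<le> N \<and> 0 < \<alpha> \<and> admissible_link \<alpha> f \<and>
      T \<in> tensors N d \<and> entry_max_norm N d T \<le> \<alpha> \<and>
      2 \<le> m \<and> m \<le> N ^ d \<and> set_pmf \<pi> \<subseteq> indices N d \<and> 0 < \<delta> \<and> \<delta> < 1 \<longrightarrow>
      (\<forall>R :: real. max_qnorm N d T \<le> R \<longrightarrow>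
        measure_pmf.prob (observation_pmf m \<pi> f T)
          {obs. \<forall>T'. is_arg_min (neg_log_likelihood m f obs) (\<lambda>X. X \<in> K_max N d \<alpha> R) T' \<longrightarrow>
             sq_dist N d \<pi> T' T \<le> Cmax * c\<^sub>2 ^ d * \<beta>_const \<alpha> f *
               (L_const \<alpha> f * R * sqrt (real d * real N / real m) +
                U_const \<alpha> f * sqrt (ln (4 / \<delta>) / real m))} \<ge> 1 - \<delta>) \<and>
      (\<forall>R :: real. M_norm N d T \<le> R \<longrightarrow>
        measure_pmf.prob (observation_pmf m \<pi> f T)
          {obs. \<forall>T'. is_arg_min (neg_log_likelihood m f obs) (\<lambda>X. X \<in> K_M N d \<alpha> R) T' \<longrightarrow>
             sq_dist N d \<pi> T' T \<le> CM * \<beta>_const \<alpha> f *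
               (L_const \<alpha> f * R * sqrt (real d * real N / real m) +
                U_const \<alpha> f * sqrt (ln (4 / \<delta>) / real m))} \<ge> 1 - \<delta>)"
\<comment> \<open>In the first witness only \<open>c\<^sub>1\<close> is absorbed; the factor
  \<open>c\<^sub>2 ^ d\<close> stays explicit because it varies with d.\<close>
proof (rule exI[of _ "40 * c\<^sub>1"], rule exI[of _ 40], intro allI impI, elim conjE, intro conjI allI impI)
  fix d N m :: nat and \<alpha> \<delta> R :: real and f \<pi> T
  assume d: "2 \<le> d" and N: "1 \<le> N" and \<alpha>: "0 < \<alpha>" and link: "admissible_link \<alpha> f"
    and T: "T \<in> tensors N d" "entry_max_norm N d T \<le> \<alpha>" and m: "2 \<le> m"
    and \<pi>: "set_pmf \<pi> \<subseteq> indices N d" and \<delta>: "0 < \<delta>" "\<delta> < 1"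
  have d1: "1 \<le> d" and m1: "1 \<le> m" using d m by auto
  note bound = likelihood_estimation_bound[OF link \<alpha> N d1 m1 \<delta> \<pi>]
  {
    assume "M_norm N d T \<le> R"
    then have "T \<in> K_M N d \<alpha> R" using T by (simp add: K_M_def)
    then show "measure_pmf.prob (observation_pmf m \<pi> f T)
          {obs. \<forall>T'. is_arg_min (neg_log_likelihood m f obs) (\<lambda>X. X \<in> K_M N d \<alpha> R) T' \<longrightarrow>
             sq_dist N d \<pi> T' T \<le> 40 * \<beta>_const \<alpha> f *
               (L_const \<alpha> f * R * sqrt (real d * real N / real m) +
                U_const \<alpha> f * sqrt (ln (4 / \<delta>) / real m))} \<ge> 1 - \<delta>"
      by (rule bound) simp
  next
    assume R: "max_qnorm N d T \<le> R"
    define c where "c = c\<^sub>1 * c\<^sub>2 ^ d"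
    have c: "1 \<le> c" unfolding c_def by (rule grothendieck_constants_ge_one[OF assms d])
    define a b where "a = L_const \<alpha> f * R * sqrt (real d * real N / real m)"
      and "b = U_const \<alpha> f * sqrt (ln (4 / \<delta>) / real m)"
    have TK: "T \<in> K_max N d \<alpha> R" using T R by (simp add: K_max_def)
    have sub: "K_max N d \<alpha> R \<subseteq> K_M N d \<alpha> (c * R)"
    proof
      fix X assume X: "X \<in> K_max N d \<alpha> R"
      then have "M_norm N d X \<le> c * max_qnorm N d X"
        using assms d N unfolding grothendieck_constants_def c_def K_max_def by blast
      also have "\<dots> \<le> c * R" using X c by (intro mult_left_mono) (auto simp: K_max_def)
      finally show "X \<in> K_M N d \<alpha> (c * R)" using X by (simp add: K_max_def K_M_def)
    qed
    have b: "0 \<le> b"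
      using U_const_pos[OF link \<alpha>] \<delta> by (auto simp: b_def intro!: mult_nonneg_nonneg divide_nonneg_nonneg)
    \<comment> \<open>The radius c R puts c on the L term alone; c >= 1 and b >= 0 let it be pulled
      out of the whole sum.\<close>
    then have "c * a + b \<le> c * (a + b)"
      using c mult_right_mono[of 1 c b] by (simp add: distrib_left)
    then have le: "40 * \<beta>_const \<alpha> f * (c * a + b) \<le> 40 * \<beta>_const \<alpha> f * (c * (a + b))"
      using beta_const_pos[OF link \<alpha>] by (intro mult_left_mono) auto
    have "1 - \<delta> \<le> measure_pmf.prob (observation_pmf m \<pi> f T)
        {obs. \<forall>T'. is_arg_min (neg_log_likelihood m f obs) (\<lambda>X. X \<in> K_max N d \<alpha> R) T' \<longrightarrow>
           sq_dist N d \<pi> T' T \<le> 40 * \<beta>_const \<alpha> f * (c * a + b)}"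
      using bound[OF TK sub] by (simp only: a_def b_def mult_ac)
    also have "\<dots> \<le> measure_pmf.prob (observation_pmf m \<pi> f T)
        {obs. \<forall>T'. is_arg_min (neg_log_likelihood m f obs) (\<lambda>X. X \<in> K_max N d \<alpha> R) T' \<longrightarrow>
           sq_dist N d \<pi> T' T \<le> 40 * c\<^sub>1 * c\<^sub>2 ^ d * \<beta>_const \<alpha> f * (a + b)}"
    proof (intro measure_pmf.finite_measure_mono subsetI CollectI allI impI)
      fix obs T'
      assume "obs \<in> {obs. \<forall>T'. is_arg_min (neg_log_likelihood m f obs) (\<lambda>X. X \<in> K_max N d \<alpha> R) T' \<longrightarrow>
           sq_dist N d \<pi> T' T \<le> 40 * \<beta>_const \<alpha> f * (c * a + b)}"
        and "is_arg_min (neg_log_likelihood m f obs) (\<lambda>X. X \<in> K_max N d \<alpha> R) T'"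
      then have "sq_dist N d \<pi> T' T \<le> 40 * \<beta>_const \<alpha> f * (c * a + b)" by blast
      also note le
      also have "40 * \<beta>_const \<alpha> f * (c * (a + b)) = 40 * c\<^sub>1 * c\<^sub>2 ^ d * \<beta>_const \<alpha> f * (a + b)"
        by (simp add: c_def)
      finally show "sq_dist N d \<pi> T' T \<le> 40 * c\<^sub>1 * c\<^sub>2 ^ d * \<beta>_const \<alpha> f * (a + b)" .
    qed simp
    finally show "measure_pmf.prob (observation_pmf m \<pi> f T)
          {obs. \<forall>T'. is_arg_min (neg_log_likelihood m f obs) (\<lambda>X. X \<in> K_max N d \<alpha> R) T' \<longrightarrow>
             sq_dist N d \<pi> T' T \<le> 40 * c\<^sub>1 * c\<^sub>2 ^ d * \<beta>_const \<alpha> f *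
               (L_const \<alpha> f * R * sqrt (real d * real N / real m) +
                U_const \<alpha> f * sqrt (ln (4 / \<delta>) / real m))} \<ge> 1 - \<delta>"
      by (simp only: a_def b_def)
  }
qed

end
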